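(* Let $G\le \mathrm{O}(d)$ be a group of orthogonal linear maps of $\mathbb{R}^d$ (not assumed closed). (a) If some orbit of $G$ is not a closed subset of $\mathbb{R}^d$, then every continuous map from $\mathbb{R}^d/G$ (with the quotient topology) to any $T_1$ topological space fails to be injective. (b) If the orbits of $G$ are the concentric spheres $\{x\in\mathbb{R}^d:\|x\|=r\}$, $r\ge 0$, centered at the origin, then for every nonzero $z\in\mathbb{R}^d$ the map $\mathbb{R}^d/G\to\mathbb{R}$, $[x]\mapsto\langle\!\langle [z],[x]\rangle\!\rangle$, is injective. (c) If every orbit of $G$ is closed and $n\ge 2d$, then for generic $(z_1,\ldots,z_n)\in(\mathbb{R}^d)^n$ the max filter bank $\mathbb{R}^d/G\to\mathbb{R}^n$, $[x]\mapsto(\langle\!\langle [z_i],[x]\rangle\!\rangle)_{i=1}^n$, is injective.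
   Context: For $x\in\mathbb{R}^d$, $[x]:=\{gx:g\in G\}$ denotes its orbit and $\mathbb{R}^d/G$ the set of orbits. The max filtering map is $\langle\!\langle [x],[y]\rangle\!\rangle:=\sup_{p\in[x],\,q\in[y]}\langle p,q\rangle$ (standard inner product). "Generic" means: the property holds for all $(z_1,\ldots,z_n)$ outside a subset of $(\mathbb{R}^d)^n\cong\mathbb{R}^{dn}$ contained in a semialgebraic set of dimension strictly less than $dn$ (in particular a closed Lebesgue-null set). *)

theory Defs
  imports "HOL-Analysis.Analysis"
begin

definition orth_group :: "('a::euclidean_space \<Rightarrow> 'a) set \<Rightarrow> bool" where
  "orth_group G \<longleftrightarrow> G \<subseteq> {f. orthogonal_transformation f} \<and> id \<in> G \<and>
     (\<forall>f\<in>G. \<forall>g\<in>G. f \<circ> g \<in> G) \<and> (\<forall>f\<in>G. inv f \<in> G)"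

definition orbit :: "('a \<Rightarrow> 'a) set \<Rightarrow> 'a \<Rightarrow> 'a set" where
  "orbit G x = (\<lambda>g. g x) ` G"

definition orbit_space :: "('a \<Rightarrow> 'a) set \<Rightarrow> 'a set set" where
  "orbit_space G = range (orbit G)"

text \<open>Quotient topology on the orbit space: a set of orbits is open iff
  its union (the preimage under the quotient map) is open.\<close>
definition quotient_top :: "('a::topological_space \<Rightarrow> 'a) set \<Rightarrow> 'a set topology" where
  "quotient_top G = topology (\<lambda>U. U \<subseteq> orbit_space G \<and> open (\<Union>U))"

definition maxfilt :: "'a::real_inner set \<Rightarrow> 'a set \<Rightarrow> real" where
  "maxfilt A B = Sup {p \<bullet> q | p q. p \<in> A \<and> q \<in> B}"

inductive_set polyfun :: "('a::euclidean_space \<Rightarrow> real) set" where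
  pconst: "(\<lambda>x. c) \<in> polyfun"
| pcoord: "b \<in> Basis \<Longrightarrow> (\<lambda>x. x \<bullet> b) \<in> polyfun"
| padd: "p \<in> polyfun \<Longrightarrow> q \<in> polyfun \<Longrightarrow> (\<lambda>x. p x + q x) \<in> polyfun"
| pmult: "p \<in> polyfun \<Longrightarrow> q \<in> polyfun \<Longrightarrow> (\<lambda>x. p x * q x) \<in> polyfun"

inductive semialgebraic :: "'a::euclidean_space set \<Rightarrow> bool" where
  sa_eq: "p \<in> polyfun \<Longrightarrow> semialgebraic {x. p x = 0}"
| sa_pos: "p \<in> polyfun \<Longrightarrow> semialgebraic {x. p x > 0}"
| sa_un: "semialgebraic S \<Longrightarrow> semialgebraic T \<Longrightarrow> semialgebraic (S \<union> T)"
| sa_int: "semialgebraic S \<Longrightarrow> semialgebraic T \<Longrightarrow> semialgebraic (S \<inter> T)"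
| sa_compl: "semialgebraic S \<Longrightarrow> semialgebraic (- S)"

definition sa_dim :: "'a::euclidean_space set \<Rightarrow> int" where
  "sa_dim S = (if S = {} then -1 else int (GREATEST k. \<exists>f::'a \<Rightarrow> 'a. linear f \<and> dim (range f) = k \<and>
      (\<exists>U. openin (top_of_set (range f)) U \<and> U \<noteq> {} \<and> U \<subseteq> f ` S)))"

definition generic :: "('a::euclidean_space \<Rightarrow> bool) \<Rightarrow> bool" where
  "generic P \<longleftrightarrow> (\<exists>E. semialgebraic E \<and> sa_dim E < int DIM('a) \<and> (\<forall>z. z \<notin> E \<longrightarrow> P z))"

end

theory Submission
  imports Defs
begin

text \<open>Part (c) rests on a nonzero polynomial in \<open>z\<close> that vanishes whenever two orbits collide.
  Let \<open>W\<close> be the set of tuples \<open>(z, x, y, p, q)\<close> with \<open>[x] \<noteq> [y]\<close>, \<open>\<bar>x\<bar>\<^sup>2 + \<bar>y\<bar>\<^sup>2 = 1\<close>, where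
  \<open>p\<^sub>i \<in> [x]\<close> and \<open>q\<^sub>i \<in> [y]\<close> maximise the inner product with \<open>z\<^sub>i\<close> and give the same maximum. If no nonzero
  polynomial in \<open>z\<close> vanished on \<open>W\<close>, some point of \<open>W\<close> would extend, for all nearby \<open>z\<close>, to a
  solution of all polynomial equations valid on \<open>W\<close>, depending differentiably on \<open>z\<close> at that point
  (a triangular system of simple roots modulo a prime ideal). As invariant polynomials separate closed
  orbits, these solutions still satisfy \<open>p\<^sub>i \<in> [x]\<close> and \<open>q\<^sub>i \<in> [y]\<close>. In a direction \<open>\<zeta>\<close> in which
  \<open>x\<close> and \<open>y\<close> are stationary, maximality then makes the derivatives of \<open>p\<^sub>i\<close> and \<open>q\<^sub>i\<close> orthogonal to
  \<open>z\<^sub>i\<close>, so differentiating the equality of the maxima gives \<open>\<zeta>\<^sub>i \<bottom> p\<^sub>i - q\<^sub>i\<close> for all \<open>i\<close>.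
  These are \<open>n\<close> independent conditions on \<open>\<zeta>\<close>, implied by the at most \<open>2d - 1\<close> conditions of
  stationarity; hence \<open>n < 2d\<close>.\<close>

section \<open>Invariant polynomials separate closed orbits\<close>

text \<open>\<open>tform k c\<close> is the homogeneous form of degree \<open>k\<close> with coefficient tensor \<open>c\<close>, whose
  entries are indexed by the words of length \<open>k\<close>; the values of \<open>c\<close> on other words are junk.
  If \<open>M\<close> is a matrix, \<open>\<lambda>w. tact M w c\<close> is the tensor of the form composed with \<open>M\<close>.\<close>
primrec tform :: "nat \<Rightarrow> ('i::finite list \<Rightarrow> real) \<Rightarrow> ('i \<Rightarrow> real) \<Rightarrow> real" where
  "tform 0 c v = c []"
| "tform (Suc k) c v = (\<Sum>a\<in>UNIV. v a * tform k (\<lambda>w. c (a # w)) v)"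

primrec tact :: "('i::finite \<Rightarrow> 'i \<Rightarrow> real) \<Rightarrow> 'i list \<Rightarrow> ('i list \<Rightarrow> real) \<Rightarrow> real" where
  "tact M [] c = c []"
| "tact M (b # w) c = (\<Sum>a\<in>UNIV. M a b * tact M w (\<lambda>w. c (a # w)))"

primrec tinner :: "nat \<Rightarrow> ('i::finite list \<Rightarrow> real) \<Rightarrow> ('i list \<Rightarrow> real) \<Rightarrow> real" where
  "tinner 0 c c' = c [] * c' []"
| "tinner (Suc k) c c' = (\<Sum>a\<in>UNIV. tinner k (\<lambda>w. c (a # w)) (\<lambda>w. c' (a # w)))"

section \<open>Linear and metric structure of coefficient tensors\<close>

lemma tform_add: "tform k (\<lambda>w. c w + c' w) v = tform k c v + tform k c' v"
  by (induction k arbitrary: c c') (simp_all add: algebra_simps sum.distrib)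

lemma tform_cmult: "tform k (\<lambda>w. r * c w) v = r * tform k c v"
  by (induction k arbitrary: c) (simp_all add: sum_distrib_left mult.left_commute)

lemma tform_zero: "tform k (\<lambda>w. 0) v = 0"
  by (induction k) simp_all

lemma tform_sum: "finite S \<Longrightarrow> tform k (\<lambda>w. \<Sum>s\<in>S. r s * c s w) v = (\<Sum>s\<in>S. r s * tform k (c s) v)"
  by (induction S rule: finite_induct) (simp_all add: tform_add tform_cmult tform_zero)

lemma tinner_add_left: "tinner k (\<lambda>w. c w + c' w) d = tinner k c d + tinner k c' d"
  by (induction k arbitrary: c c' d) (simp_all add: algebra_simps sum.distrib)

lemma tinner_cmult_left: "tinner k (\<lambda>w. r * c w) d = r * tinner k c d"
  by (induction k arbitrary: c d) (simp_all add: sum_distrib_left)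

lemma tinner_zero_left: "tinner k (\<lambda>w. 0) d = 0"
  by (induction k arbitrary: d) simp_all

lemma tinner_sum_left: "finite S \<Longrightarrow> tinner k (\<lambda>w. \<Sum>s\<in>S. r s * c s w) d = (\<Sum>s\<in>S. r s * tinner k (c s) d)"
  by (induction S rule: finite_induct) (simp_all add: tinner_add_left tinner_cmult_left tinner_zero_left)

lemma tinner_commute: "tinner k c d = tinner k d c"
  by (induction k arbitrary: c d) (auto intro: sum.cong)

lemma tinner_sum_right: "finite S \<Longrightarrow> tinner k d (\<lambda>w. \<Sum>s\<in>S. r s * c s w) = (\<Sum>s\<in>S. r s * tinner k d (c s))"
  using tinner_sum_left[of S k r c d] by (simp add: tinner_commute)

lemma tinner_nonneg: "0 \<le> tinner k c c"
  by (induction k arbitrary: c) (auto intro: sum_nonneg)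

text \<open>This gives uniqueness of least norm: the midpoint of two tensors of equal norm is
  shorter unless their difference has norm 0.\<close>

lemma tinner_parallelogram:
  "tinner k (\<lambda>w. (c w + c' w) / 2) (\<lambda>w. (c w + c' w) / 2)
     = (tinner k c c + tinner k c' c') / 2 - tinner k (\<lambda>w. c w - c' w) (\<lambda>w. c w - c' w) / 4"
proof (induction k arbitrary: c c')
  case (Suc k)
  then show ?case by (simp add: sum.distrib sum_subtractf flip: sum_divide_distrib)
qed (simp add: field_simps)

lemma square_le_tinner: "length w = k \<Longrightarrow> (c w)\<^sup>2 \<le> tinner k c c"
proof (induction w arbitrary: c k)
  case Nil then show ?case by (auto simp: power2_eq_square)
next
  case (Cons a w)
  then obtain l where k: "k = Suc l" "length w = l" by auto
  have "(c (a # w))\<^sup>2 \<le> tinner l (\<lambda>w. c (a # w)) (\<lambda>w. c (a # w))"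
    using Cons.IH[OF k(2), of "\<lambda>w. c (a # w)"] .
  also have "\<dots> \<le> tinner k c c"
    unfolding k(1) tinner.simps by (rule member_le_sum) (auto simp: tinner_nonneg)
  finally show ?case .
qed

lemma tform_eq_0_if_tinner_eq_0: "tinner k c c = 0 \<Longrightarrow> tform k c v = 0"
proof (induction k arbitrary: c)
  case (Suc k)
  then have "tinner k (\<lambda>w. c (a # w)) (\<lambda>w. c (a # w)) = 0" for a
    by (simp add: sum_nonneg_eq_0_iff tinner_nonneg)
  then show ?case using Suc.IH by simp
qed simp

lemma tform_cong: "(\<And>w. length w = k \<Longrightarrow> c w = c' w) \<Longrightarrow> tform k c v = tform k c' v"
proof (induction k arbitrary: c c')
  case (Suc k)
  have "tform k (\<lambda>w. c (a # w)) v = tform k (\<lambda>w. c' (a # w)) v" for a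
    by (rule Suc.IH) (simp add: Suc.prems)
  then show ?case by simp
qed simp

lemma tinner_cong:
  "(\<And>w. length w = k \<Longrightarrow> c w = c' w) \<Longrightarrow> (\<And>w. length w = k \<Longrightarrow> d w = d' w) \<Longrightarrow>
    tinner k c d = tinner k c' d'"
proof (induction k arbitrary: c c' d d')
  case (Suc k)
  have "tinner k (\<lambda>w. c (a # w)) (\<lambda>w. d (a # w)) = tinner k (\<lambda>w. c' (a # w)) (\<lambda>w. d' (a # w))" for a
    by (rule Suc.IH) (simp_all add: Suc.prems)
  then show ?case by simp
qed simp

lemma tform_tact: "tform k (\<lambda>w. tact M w c) v = tform k c (\<lambda>a. \<Sum>b\<in>UNIV. M a b * v b)"
proof (induction k arbitrary: c)
  case (Suc k)
  have "tform (Suc k) (\<lambda>w. tact M w c) v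
      = (\<Sum>b\<in>UNIV. \<Sum>a\<in>UNIV. v b * (M a b * tform k (\<lambda>w. c (a # w)) (\<lambda>a. \<Sum>b\<in>UNIV. M a b * v b)))"
    by (simp add: tform_sum Suc.IH sum_distrib_left)
  also have "\<dots> = (\<Sum>a\<in>UNIV. \<Sum>b\<in>UNIV. v b * (M a b * tform k (\<lambda>w. c (a # w)) (\<lambda>a. \<Sum>b\<in>UNIV. M a b * v b)))"
    by (rule sum.swap)
  also have "\<dots> = tform (Suc k) c (\<lambda>a. \<Sum>b\<in>UNIV. M a b * v b)"
    by (simp add: sum_distrib_right mult_ac)
  finally show ?case .
qed simp

text \<open>Induction on the order contracts one index at a time. Once the sum over \<open>b\<close>
  is innermost, orthonormality of the rows of \<open>M\<close> leaves only the diagonal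
  \<open>a = a'\<close>.\<close>

lemma tinner_tact:
  assumes M: "\<And>a a'. (\<Sum>b\<in>UNIV. M a b * M a' b) = (if a = a' then 1 else 0)"
  shows "tinner k (\<lambda>w. tact M w c) (\<lambda>w. tact M w c') = tinner k c c'"
proof (induction k arbitrary: c c')
  case (Suc k)
  let ?t = "\<lambda>a a'. tinner k (\<lambda>w. c (a # w)) (\<lambda>w. c' (a' # w))"
  have "tinner (Suc k) (\<lambda>w. tact M w c) (\<lambda>w. tact M w c')
      = (\<Sum>b\<in>UNIV. \<Sum>a\<in>UNIV. \<Sum>a'\<in>UNIV. M a b * M a' b * ?t a a')"
    by (simp add: tinner_sum_left tinner_sum_right Suc.IH sum_distrib_left mult.assoc)
  also have "\<dots> = (\<Sum>a\<in>UNIV. \<Sum>b\<in>UNIV. \<Sum>a'\<in>UNIV. M a b * M a' b * ?t a a')"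
    by (rule sum.swap)
  also have "\<dots> = (\<Sum>a\<in>UNIV. \<Sum>a'\<in>UNIV. \<Sum>b\<in>UNIV. M a b * M a' b * ?t a a')"
    by (intro sum.cong refl sum.swap)
  also have "\<dots> = (\<Sum>a\<in>UNIV. \<Sum>a'\<in>UNIV. (if a = a' then 1 else 0) * ?t a a')"
    by (simp add: sum_distrib_right[symmetric] M)
  also have "\<dots> = tinner (Suc k) c c'"
    by (simp add: if_distrib[of "\<lambda>r. r * _"] cong: if_cong)
  finally show ?case .
qed simp

text \<open>Tensor product: a word of length \<open>k + l\<close> is split after its first
  \<open>k\<close> letters.\<close>

lemma tform_mult:
  "tform (k + l) (\<lambda>w. c (take k w) * c' (drop k w)) v = tform k c v * tform l c' v"
proof (induction k arbitrary: c)
  case (Suc k)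
  have "tform (k + l) (\<lambda>w. c (a # take k w) * c' (drop k w)) v = tform k (\<lambda>w. c (a # w)) v * tform l c' v" for a
    using Suc.IH[of "\<lambda>w. c (a # w)"] .
  then show ?case by (simp add: sum_distrib_right mult.assoc)
qed (simp add: tform_cmult)

lemma continuous_on_tform:
  "(\<And>w. continuous_on S (\<lambda>x. f x w)) \<Longrightarrow> continuous_on S (\<lambda>x. tform k (f x) v)"
  by (induction k arbitrary: f) (auto intro!: continuous_intros)

lemma continuous_on_tinner:
  "(\<And>w. continuous_on S (\<lambda>x. f x w)) \<Longrightarrow> (\<And>w. continuous_on S (\<lambda>x. g x w)) \<Longrightarrow>
    continuous_on S (\<lambda>x. tinner k (f x) (g x))"
  by (induction k arbitrary: f g) (auto intro!: continuous_intros)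

text \<open>A coordinate \<open>None\<close> with value 1 turns inhomogeneous polynomials into forms.\<close>
definition homog :: "real^'d \<Rightarrow> 'd option \<Rightarrow> real" where
  "homog x a = (case a of None \<Rightarrow> 1 | Some j \<Rightarrow> x $ j)"

lemma sum_option: "(\<Sum>a\<in>UNIV. f a) = f None + (\<Sum>j\<in>UNIV. f (Some j))"
  for f :: "'d::finite option \<Rightarrow> real"
  by (simp add: UNIV_option_conv sum.reindex)

text \<open>Each extra degree is a factor \<open>homog x None\<close>, which is 1: the new tensor
  lives on words with \<open>None\<close> put in front.\<close>

lemma tform_raise_degree: "\<exists>c'. \<forall>x. tform (k + m) c' (homog x) = tform k c (homog x)"
proof (induction m)
  case (Suc m)
  then obtain c' where c': "\<And>x. tform (k + m) c' (homog x) = tform k c (homog x)" by blast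
  have "tform (Suc (k + m)) (\<lambda>w. if hd w = None then c' (tl w) else 0) (homog x) = tform k c (homog x)" for x
    by (simp add: sum_option tform_zero c' homog_def[of x None])
  then show ?case by (metis add_Suc_right)
qed auto

lemma real_polynomial_function_tform:
  fixes f :: "real^'d \<Rightarrow> real"
  assumes "real_polynomial_function f"
  shows "\<exists>k c. \<forall>x. f x = tform k c (homog x)"
  using assms
proof induction
  case (linear f)
  then interpret bounded_linear f .
  have *: "f x = (\<Sum>j\<in>UNIV. x $ j * f (axis j 1))" for x
  proof -
    have "f x = f (\<Sum>j\<in>UNIV. x $ j *\<^sub>R axis j 1)"
      by (simp add: basis_expansion flip: scalar_mult_eq_scaleR)
    then show ?thesis by (simp add: sum scaleR)
  qed
  have "f x = tform (Suc 0) (\<lambda>w. case hd w of None \<Rightarrow> 0 | Some j \<Rightarrow> f (axis j 1)) (homog x)" for x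
    by (subst *) (simp add: sum_option homog_def)
  then show ?case by blast
next
  case (const c)
  have "c = tform 0 (\<lambda>_. c) (homog x)" for x :: "real^'d" by simp
  then show ?case by blast
next
  case (add f g)
  then obtain k c l d where
    fg: "\<And>x. f x = tform k c (homog x)" "\<And>x. g x = tform l d (homog x)" by blast
  \<comment> \<open>Tensors can be added only at a common degree, here \<open>k + l\<close>.\<close>
  obtain c' where c': "\<And>x. tform (k + l) c' (homog x) = f x"
    using tform_raise_degree[of k l c] fg by auto
  obtain d' where d': "\<And>x. tform (l + k) d' (homog x) = g x"
    using tform_raise_degree[of l k d] fg by auto
  have "f x + g x = tform (k + l) (\<lambda>w. c' w + d' w) (homog x)" for x
    using d' by (simp add: tform_add c' add.commute)
  then show ?case by blast
next
  case (mult f g)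
  then obtain k c l d where
    "\<And>x. f x = tform k c (homog x)" "\<And>x. g x = tform l d (homog x)" by blast
  then have "f x * g x = tform (k + l) (\<lambda>w. c (take k w) * d (drop k w)) (homog x)" for x
    by (simp add: tform_mult)
  then show ?case by blast
qed

text \<open>Block diagonal matrix with blocks 1 and \<open>g\<close>: it keeps the added coordinate
  at 1 and inherits orthogonality from \<open>g\<close>.\<close>

definition homog_mat :: "(real^'d \<Rightarrow> real^'d) \<Rightarrow> 'd option \<Rightarrow> 'd option \<Rightarrow> real" where
  "homog_mat g a b = (case (a, b) of (None, None) \<Rightarrow> 1 | (Some i, Some j) \<Rightarrow> g (axis j 1) $ i | _ \<Rightarrow> 0)"

lemma homog_mat_mult:
  assumes "linear g"
  shows "(\<lambda>a. \<Sum>b\<in>UNIV. homog_mat g a b * homog x b) = homog (g x)"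
proof
  fix a
  have "g x $ i = (\<Sum>j\<in>UNIV. g (axis j 1) $ i * x $ j)" for i
  proof -
    have "g x = g (\<Sum>j\<in>UNIV. x $ j *\<^sub>R axis j 1)"
      by (simp add: basis_expansion flip: scalar_mult_eq_scaleR)
    also have "\<dots> = (\<Sum>j\<in>UNIV. x $ j *\<^sub>R g (axis j 1))"
      using assms by (simp add: linear_sum linear_scale)
    finally show ?thesis by (simp add: mult.commute)
  qed
  then show "(\<Sum>b\<in>UNIV. homog_mat g a b * homog x b) = homog (g x) a"
    by (cases a) (simp_all add: sum_option homog_mat_def homog_def)
qed

lemma homog_mat_orthogonal:
  fixes g :: "real^'d \<Rightarrow> real^'d"
  assumes "orthogonal_transformation g"
  shows "(\<Sum>b\<in>UNIV. homog_mat g a b * homog_mat g a' b) = (if a = a' then 1 else 0)"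
proof -
  have "orthogonal_matrix (matrix g)"
    using assms by (simp add: orthogonal_transformation_matrix)
  then have "matrix g ** transpose (matrix g) = mat 1"
    by (simp add: orthogonal_matrix_def)
  then have *: "(matrix g ** transpose (matrix g)) $ i $ k = (mat 1 :: real^'d^'d) $ i $ k" for i k
    by simp
  have "(\<Sum>j\<in>UNIV. g (axis j 1) $ i * g (axis j 1) $ k) = (if i = k then 1 else 0)" for i k
    using *[of i k] by (simp add: matrix_matrix_mult_def transpose_def matrix_def mat_def)
  then show ?thesis
    by (cases a; cases a') (simp_all add: sum_option homog_mat_def)
qed

text \<open>Tychonoff. Tensors are functions on all words, hence points of an infinite product,
  where closed and bounded does not suffice.\<close>

lemma compact_Pi_UNIV:
  fixes S :: "'i \<Rightarrow> 'a::topological_space set"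
  assumes "\<And>i. compact (S i)"
  shows "compact (PiE UNIV S)"
proof -
  have "compactin (product_topology (\<lambda>i. euclidean) UNIV) (PiE UNIV S)"
    using assms by (simp add: compactin_PiE)
  then show ?thesis by (simp add: euclidean_product_topology)
qed

text \<open>The tensor of least norm in the convex set of tensors whose form separates the two orbits is
  unique, hence fixed by the group.\<close>
lemma invariant_tform_separates:
  fixes A B :: "(real^'d) set"
  assumes G: "G \<subseteq> {g. orthogonal_transformation g}"
    and inv: "\<And>g u. g \<in> G \<Longrightarrow> u \<in> A \<Longrightarrow> g u \<in> A" "\<And>g u. g \<in> G \<Longrightarrow> u \<in> B \<Longrightarrow> g u \<in> B"
    and AB: "compact A" "compact B" "A \<inter> B = {}"
  obtains k c where "\<And>g u. g \<in> G \<Longrightarrow> tform k c (homog (g u)) = tform k c (homog u)"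
    "\<And>u v. u \<in> A \<Longrightarrow> v \<in> B \<Longrightarrow> tform k c (homog u) < tform k c (homog v)"
proof -
  obtain f :: "real^'d \<Rightarrow> real" where f: "continuous_on UNIV f" "\<And>x. x \<in> A \<Longrightarrow> f x = 0" "\<And>x. x \<in> B \<Longrightarrow> f x = 1"
    using Urysohn[of A B 0 1] AB compact_imp_closed by metis
  obtain p where p: "real_polynomial_function p" "\<And>x. x \<in> A \<union> B \<Longrightarrow> \<bar>f x - p x\<bar> < 1/3"
    using Stone_Weierstrass_real_polynomial_function[of "A \<union> B" f "1/3"] AB f(1)
    by (metis compact_Un continuous_on_subset subset_UNIV zero_less_divide_1_iff zero_less_numeral)
  obtain k c0 where kc: "\<And>x. p x = tform k c0 (homog x)"
    using real_polynomial_function_tform[OF p(1)] by blast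
  \<comment> \<open>An error below 1/3 keeps \<open>p\<close> below 1/3 on \<open>A\<close> and
    above 2/3 on \<open>B\<close>. The weak inequalities make \<open>K\<close> closed as well as
    convex.\<close>
  define K where "K = {c. (\<forall>u\<in>A. tform k c (homog u) \<le> 1/3) \<and> (\<forall>u\<in>B. 2/3 \<le> tform k c (homog u))}"
  have c0: "c0 \<in> K"
    unfolding K_def using p(2) f(2,3) by (force simp flip: kc simp: abs_if split: if_splits)
  \<comment> \<open>The summand 1 ensures \<open>r \<le> r\<^sup>2\<close>, so that
    \<open>(c w)\<^sup>2 \<le> r\<close> implies \<open>\<bar>c w\<bar> \<le> r\<close>.\<close>
  define r where "r = tinner k c0 c0 + 1"
  \<comment> \<open>Entries on words of the wrong length are pinned to 0; \<open>cut\<close> below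
    does this without changing the form or the norm.\<close>
  define S where "S w = (if length w = k then {-r..r} else {0::real})" for w :: "'d option list"
  define D where "D = PiE UNIV S \<inter> K"
  have cont: "continuous_on T (\<lambda>c. c w)" for T and w :: "'d option list"
    by (rule continuous_on_subset[OF continuous_on_product_coordinates]) simp
  have "closed K"
  proof -
    have "K = (\<Inter>u\<in>A. {c. tform k c (homog u) \<le> 1/3}) \<inter> (\<Inter>u\<in>B. {c. 2/3 \<le> tform k c (homog u)})"
      by (auto simp: K_def)
    then show ?thesis
      by (auto intro!: closed_Int closed_INT closed_Collect_le continuous_on_tform cont continuous_intros)
  qed
  moreover have "compact (PiE UNIV S)"
    by (rule compact_Pi_UNIV) (auto simp: S_def)
  ultimately have "compact D" by (auto simp: D_def intro: compact_Int_closed)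
  define cut where "cut c w = (if length w = k then c w else (0::real))" for c and w :: "'d option list"
  have cut: "tform k (cut c) v = tform k c v" "tinner k (cut c) (cut c) = tinner k c c" for c v
    by (auto simp: cut_def intro: tform_cong tinner_cong)
  have cutD: "cut c \<in> D" if "c \<in> K" "tinner k c c \<le> tinner k c0 c0" for c
  proof -
    have "cut c w \<in> S w" for w
    proof (cases "length w = k")
      case True
      have "(c w)\<^sup>2 \<le> r" using square_le_tinner[OF True, of c] that by (simp add: r_def)
      moreover have "r \<le> r\<^sup>2" "0 \<le> r"
        using tinner_nonneg[of k c0] by (auto simp: r_def power2_eq_square)
      ultimately have "\<bar>c w\<bar> \<le> r" by (meson order_trans power2_le_iff_abs_le)
      then show ?thesis using True by (auto simp: cut_def S_def)
    qed (auto simp: cut_def S_def)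
    then show ?thesis using that by (auto simp: D_def K_def cut)
  qed
  have "D \<noteq> {}" using cutD[OF c0] by auto
  then obtain c where c: "c \<in> D" and cmin: "\<And>c'. c' \<in> D \<Longrightarrow> tinner k c c \<le> tinner k c' c'"
    using continuous_attains_inf[OF \<open>compact D\<close>, of "\<lambda>c. tinner k c c"]
      continuous_on_tinner[of D "\<lambda>c. c" "\<lambda>c. c" k, OF cont cont] by blast
  have cK: "c \<in> K" using c by (simp add: D_def)
  \<comment> \<open>A tensor longer than \<open>c0\<close> loses to \<open>c0\<close>, and any other
    one has its truncation in \<open>D\<close>, so the minimum over \<open>D\<close> is one over
    \<open>K\<close>.\<close>
  have min: "tinner k c c \<le> tinner k c' c'" if "c' \<in> K" for c'
  proof (cases "tinner k c' c' \<le> tinner k c0 c0")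
    case True then show ?thesis using cmin[OF cutD[OF that]] by (simp add: cut)
  next
    case False then show ?thesis using cmin[OF cutD[OF c0]] by (simp add: cut)
  qed
  have midp: "a \<le> 1/3 \<Longrightarrow> b \<le> 1/3 \<Longrightarrow> (a + b) / 2 \<le> 1/3"
    "2/3 \<le> a \<Longrightarrow> 2/3 \<le> b \<Longrightarrow> 2/3 \<le> (a + b) / 2" 
    and sepp: "a \<le> 1/3 \<Longrightarrow> 2/3 \<le> b \<Longrightarrow> a < b" for a b :: real
    by simp_all
  show thesis
  proof
    fix g u assume g: "g \<in> G"
    then have og: "orthogonal_transformation g" using G by blast
    define c' where "c' = (\<lambda>w. tact (homog_mat g) w c)"
    have c': "tform k c' (homog u) = tform k c (homog (g u))" for u
      unfolding c'_def by (simp add: tform_tact homog_mat_mult orthogonal_transformation_linear[OF og])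
    have n: "tinner k c' c' = tinner k c c"
      unfolding c'_def by (rule tinner_tact) (rule homog_mat_orthogonal[OF og])
    have mid: "tform k (\<lambda>w. (c w + c' w) / 2) v = (tform k c v + tform k c' v) / 2" for v
      using tform_cmult[of k "1/2" "\<lambda>w. c w + c' w" v] by (simp add: tform_add)
    have "(tform k c (homog v) + tform k c (homog (g v))) / 2 \<le> 1/3" if "v \<in> A" for v
    proof -
      have "tform k c (homog v) \<le> 1/3" "tform k c (homog (g v)) \<le> 1/3"
        using cK inv(1)[OF g that] that by (auto simp: K_def)
      then show ?thesis using midp(1) by blast
    qed
    moreover have "2/3 \<le> (tform k c (homog v) + tform k c (homog (g v))) / 2" if "v \<in> B" for v
    proof -
      have "2/3 \<le> tform k c (homog v)" "2/3 \<le> tform k c (homog (g v))"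
        using cK inv(2)[OF g that] that by (auto simp: K_def)
      then show ?thesis using midp(2) by blast
    qed
    \<comment> \<open>Convexity puts the midpoint of \<open>c\<close> and \<open>c'\<close> into
      \<open>K\<close>. Both have the same norm, so minimality leaves no room for the last term of
      the parallelogram law.\<close>
    ultimately have "(\<lambda>w. (c w + c' w) / 2) \<in> K"
      unfolding K_def mem_Collect_eq mid c' by blast
    from min[OF this] have "tinner k (\<lambda>w. c w - c' w) (\<lambda>w. c w - c' w) \<le> 0"
      by (simp add: tinner_parallelogram n)
    then have "tinner k (\<lambda>w. c w - c' w) (\<lambda>w. c w - c' w) = 0"
      by (simp add: tinner_nonneg order_antisym)
    then have "tform k (\<lambda>w. c w - c' w) (homog u) = 0" by (rule tform_eq_0_if_tinner_eq_0)
    then show "tform k c (homog (g u)) = tform k c (homog u)"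
      using tform_add[of k "\<lambda>w. c w - c' w" c' "homog u"] by (simp add: c')
  next
    fix u v assume "u \<in> A" "v \<in> B"
    then have "tform k c (homog u) \<le> 1/3" "2/3 \<le> tform k c (homog v)" using cK by (auto simp: K_def)
    then show "tform k c (homog u) < tform k c (homog v)" using sepp by blast
  qed
qed

section \<open>Solving polynomial equations along an ultrafilter\<close>

text \<open>Zorn's lemma on the nontrivial filters below \<open>F\<close>. What holds eventually for
  the infimum of a chain holds so for a member, so the infimum is nontrivial. A finest filter
  decides every \<open>Q\<close>, since otherwise restricting it to \<open>Q\<close> would refine
  it.\<close>

lemma ultrafilter_exists:
  fixes F :: "'a filter"
  assumes "F \<noteq> bot"
  obtains U where "U \<le> F" "U \<noteq> bot" "\<And>Q. eventually Q U \<or> eventually (\<lambda>x. \<not> Q x) U"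
proof -
  define A where "A = {F'. F' \<le> F \<and> F' \<noteq> bot}"
  have "\<exists>M\<in>A. \<forall>F'\<in>A. F' \<le> M \<longrightarrow> F' = M"
  proof (rule predicate_Zorn)
    show "partial_order_on A (relation_of (\<lambda>F G. G \<le> F) A)"
      by (rule partial_order_on_relation_ofI) auto
  next
    fix C assume C: "C \<in> Chains (relation_of (\<lambda>F G. G \<le> F) A)"
    then have CA: "C \<subseteq> A" and lin: "\<And>F G. F \<in> C \<Longrightarrow> G \<in> C \<Longrightarrow> F \<le> G \<or> G \<le> F"
      unfolding Chains_def relation_of_def by blast+
    show "\<exists>M\<in>A. \<forall>F'\<in>C. M \<le> F'"
    proof (cases "C = {}")
      case True then show ?thesis using assms by (auto simp: A_def)
    next
      case False
      have "eventually P (Inf C) \<longleftrightarrow> (\<exists>F'\<in>C. eventually P F')" for P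
      proof (rule eventually_Inf_base[OF False])
        fix F G assume "F \<in> C" "G \<in> C"
        then show "\<exists>x\<in>C. x \<le> inf F G" using lin[of F G] by auto
      qed
      then have "Inf C \<noteq> bot"
        using CA unfolding trivial_limit_def A_def by blast
      moreover have "Inf C \<le> F"
        using False CA by (auto simp: A_def intro: Inf_lower2)
      ultimately show ?thesis by (auto simp: A_def intro: Inf_lower)
    qed
  qed
  then obtain M where M: "M \<le> F" "M \<noteq> bot"
    and max: "\<And>F'. F' \<le> F \<Longrightarrow> F' \<noteq> bot \<Longrightarrow> F' \<le> M \<Longrightarrow> F' = M"
    unfolding A_def by blast
  have "eventually Q M" if "\<not> eventually (\<lambda>x. \<not> Q x) M" for Q
  proof -
    let ?N = "inf M (principal {x. Q x})"
    have "?N \<noteq> bot" using that by (simp add: trivial_limit_def eventually_inf_principal)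
    moreover have "?N \<le> F" using M(1) by (meson inf.coboundedI1)
    ultimately have "?N = M" using max by simp
    moreover have "eventually Q ?N" by (simp add: eventually_inf_principal)
    ultimately show ?thesis by simp
  qed
  then show thesis using that M by blast
qed

text \<open>On the line through \<open>a\<close> and \<open>x\<close> the function is a univariate
  polynomial with infinitely many roots near \<open>a\<close>.\<close>

lemma real_polynomial_function_eq_0_if_open:
  fixes f :: "'a::real_normed_vector \<Rightarrow> real"
  assumes f: "real_polynomial_function f" and S: "open S" "a \<in> S" and 0: "\<And>x. x \<in> S \<Longrightarrow> f x = 0"
  shows "f x = 0"
proof -
  have "real_polynomial_function (f \<circ> (\<lambda>t. a + t *\<^sub>R (x - a)))"
  proof (rule real_polynomial_function_compose)
    show "polynomial_function (\<lambda>t. a + t *\<^sub>R (x - a))"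
      by (intro polynomial_function_add polynomial_function_const
          polynomial_function_bounded_linear bounded_linear_scaleR_left)
  qed (rule f)
  then obtain c n where c: "\<And>t. f (a + t *\<^sub>R (x - a)) = (\<Sum>i\<le>n. c i * t ^ i)"
    unfolding real_polynomial_function_iff_sum o_def by metis
  have "((\<lambda>t. a + t *\<^sub>R (x - a)) \<longlongrightarrow> a + 0 *\<^sub>R (x - a)) (at 0)"
    by (intro tendsto_intros)
  then have "eventually (\<lambda>t. a + t *\<^sub>R (x - a) \<in> S) (at 0)"
    using S by (simp add: tendsto_def)
  then obtain d where d: "d > 0" "\<And>t. t \<noteq> 0 \<Longrightarrow> \<bar>t\<bar> < d \<Longrightarrow> a + t *\<^sub>R (x - a) \<in> S"
    unfolding eventually_at by (auto simp: dist_real_def)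
  have "{0<..<d} \<subseteq> {t. (\<Sum>i\<le>n. c i * t ^ i) = 0}"
    using d 0 by (auto simp flip: c)
  then have "infinite {t. (\<Sum>i\<le>n. c i * t ^ i) = 0}"
    using infinite_Ioo[OF d(1)] finite_subset by blast
  then have "\<forall>i\<le>n. c i = 0"
    by (metis polyfun_finite_roots)
  then show ?thesis using c[of 1] by simp
qed

section \<open>Polynomials in a chosen set of variables\<close>

inductive_set pol :: "'v::finite set \<Rightarrow> (real^'v \<Rightarrow> real) set" for V where
  pol_const: "(\<lambda>e. c) \<in> pol V"
| pol_var: "v \<in> V \<Longrightarrow> (\<lambda>e. e $ v) \<in> pol V"
| pol_add: "p \<in> pol V \<Longrightarrow> q \<in> pol V \<Longrightarrow> (\<lambda>e. p e + q e) \<in> pol V"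
| pol_mult: "p \<in> pol V \<Longrightarrow> q \<in> pol V \<Longrightarrow> (\<lambda>e. p e * q e) \<in> pol V"

lemma pol_mono:
  assumes "f \<in> pol V" "V \<subseteq> W"
  shows "f \<in> pol W"
  using assms(1) by induction (use assms(2) in \<open>auto intro: pol.intros\<close>)

lemma pol_cong:
  assumes "f \<in> pol V" "\<And>v. v \<in> V \<Longrightarrow> e $ v = e' $ v"
  shows "f e = f e'"
  using assms(1) by induction (auto simp: assms(2))

lemma pol_diff: "p \<in> pol V \<Longrightarrow> q \<in> pol V \<Longrightarrow> (\<lambda>e. p e - q e) \<in> pol V"
  using pol_add[OF _ pol_mult[OF pol_const[of "-1"]], of p V q] by simp

lemma pol_sum: "(\<And>i. i \<in> S \<Longrightarrow> p i \<in> pol V) \<Longrightarrow> (\<lambda>e. \<Sum>i\<in>S. p i e) \<in> pol V"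
  by (induction S rule: infinite_finite_induct) (auto intro: pol.intros)

lemma pol_power: "p \<in> pol V \<Longrightarrow> (\<lambda>e. p e ^ n) \<in> pol V"
  by (induction n) (auto intro: pol.intros)

lemma pol_real_polynomial_function: "f \<in> pol V \<Longrightarrow> real_polynomial_function f"
  by (induction rule: pol.induct) (auto simp: bounded_linear_vec_nth)

text \<open>Absence of zero divisors: \<open>g\<close> vanishes on the nonempty open set where
  \<open>f\<close> does not.\<close>

lemma pol_mult_eq_0:
  assumes f: "f \<in> pol V" and g: "g \<in> pol V" and 0: "\<And>e. f e * g e = 0" and "f a \<noteq> 0"
  shows "g e = 0"
proof -
  have "continuous_on UNIV f"
    using pol_real_polynomial_function[OF f] continuous_on_polymonial_function real_polynomial_function_eq by blast
  then have "open (- {x. f x = 0})"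
    by (simp add: closed_Collect_eq open_Compl)
  moreover have "g x = 0" if "x \<in> - {x. f x = 0}" for x using 0[of x] that by simp
  ultimately show ?thesis
    using real_polynomial_function_eq_0_if_open[OF pol_real_polynomial_function[OF g], of "- {x. f x = 0}" a]
      \<open>f a \<noteq> 0\<close> by simp
qed

text \<open>Polynomials in one more variable are treated as univariate polynomials over \<open>pol V\<close>; \<open>D\<close> is only
  an upper bound for the degree, so the coefficient at \<open>D\<close> may vanish.\<close>
definition cpol :: "'v::finite set \<Rightarrow> nat \<Rightarrow> (real^'v \<Rightarrow> real poly) set" where
  "cpol V D = {q. (\<forall>i. (\<lambda>e. coeff (q e) i) \<in> pol V) \<and> (\<forall>e. degree (q e) \<le> D)}"

lemma cpol_mono: "q \<in> cpol V D \<Longrightarrow> D \<le> D' \<Longrightarrow> q \<in> cpol V D'"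
  unfolding cpol_def using order_trans by blast

lemma pol_insert_cpol:
  assumes "f \<in> pol (insert u V)"
  shows "\<exists>D. \<exists>q\<in>cpol V D. \<forall>e. f e = poly (q e) (e $ u)"
  using assms
proof induction
  case (pol_const c)
  have "(\<lambda>e. [:c:]) \<in> cpol V 0"
    by (auto simp: cpol_def coeff_pCons split: nat.split intro: pol.intros)
  then show ?case by force
next
  case (pol_var v)
  show ?case
  proof (cases "v = u")
    case True
    have "(\<lambda>e. [:0, 1:]) \<in> cpol V 1"
      by (auto simp: cpol_def coeff_pCons split: nat.split intro: pol.intros)
    then show ?thesis using True by force
  next
    case False
    have "(\<lambda>e. coeff [:e $ v:] i) \<in> pol V" for i
      using False pol_var by (cases i) (auto intro: pol.intros)
    then have "(\<lambda>e. [:e $ v:]) \<in> cpol V 0" by (simp add: cpol_def)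
    then show ?thesis by force
  qed
next
  case (pol_add p q)
  then obtain D p' E q' where *: "p' \<in> cpol V D" "\<And>e. p e = poly (p' e) (e $ u)"
    "q' \<in> cpol V E" "\<And>e. q e = poly (q' e) (e $ u)" by blast
  have "p' \<in> cpol V (max D E)" "q' \<in> cpol V (max D E)"
    using *(1,3) by (auto intro: cpol_mono)
  then have "(\<lambda>e. p' e + q' e) \<in> cpol V (max D E)"
    by (simp add: cpol_def pol.pol_add degree_add_le)
  then show ?case using * by force
next
  case (pol_mult p q)
  then obtain D p' E q' where *: "p' \<in> cpol V D" "\<And>e. p e = poly (p' e) (e $ u)"
    "q' \<in> cpol V E" "\<And>e. q e = poly (q' e) (e $ u)" by blast
  have "degree (p' e * q' e) \<le> D + E" for e
    using *(1,3) degree_mult_le[of "p' e" "q' e"] unfolding cpol_def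
    by (metis (mono_tags, lifting) add_mono_thms_linordered_semiring(1) mem_Collect_eq order_trans)
  then have "(\<lambda>e. p' e * q' e) \<in> cpol V (D + E)"
    using *(1,3) by (auto simp: cpol_def coeff_mult intro!: pol_sum pol.pol_mult)
  then show ?case using * by force
qed

lemma cpol_poly_pol: 
  assumes "q \<in> cpol V D"
  shows "(\<lambda>e. poly (q e) (e $ u)) \<in> pol (insert u V)"
proof -
  have "poly (q e) x = (\<Sum>i\<le>D. coeff (q e) i * x ^ i)" for e x
    using assms by (auto simp: cpol_def poly_altdef intro!: sum.mono_neutral_left coeff_eq_0)
  then show ?thesis
    using assms pol_mono[of _ V "insert u V"]
    by (auto simp: cpol_def intro!: pol_sum pol_mult pol_power pol_var)
qed

lemma cpol_pderiv: "q \<in> cpol V (Suc D) \<Longrightarrow> (\<lambda>e. pderiv (q e)) \<in> cpol V D"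
  by (simp add: cpol_def coeff_pderiv degree_pderiv pol_mult pol_const le_diff_conv)

text \<open>The root is taken closest to the value predicted by the derivative, so that
  differentiability of \<open>F\<close> at a single point is enough.\<close>
lemma differentiable_root_function:
  fixes F :: "'a::real_normed_vector \<Rightarrow> real \<Rightarrow> real"
  assumes F0: "F e0 t0 = 0"
    and der: "((\<lambda>s. F (fst s) (snd s)) has_derivative (\<lambda>s. A (fst s) + snd s)) (at (e0, t0))"
    and cont: "\<And>e. continuous_on UNIV (F e)"
    and A: "bounded_linear A"
  obtains r where "r e0 = t0" "r differentiable (at e0)" "eventually (\<lambda>e. F e (r e) = 0) (nhds e0)"
proof -
  \<comment> \<open>First-order prediction of the root; the derivative of \<open>F\<close> in
    \<open>t\<close> is 1.\<close>
  define L where "L e = t0 - A (e - e0)" for e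
  define Z where "Z e = {t. F e t = 0}" for e
  have closed: "closed (Z e)" for e
    unfolding Z_def using cont by (simp add: closed_Collect_eq)
  obtain K where K: "K > 0" "\<And>x. norm (A x) \<le> norm x * K"
    using bounded_linear.pos_bounded[OF A] by blast
  \<comment> \<open>At distance \<open>\<eta> * norm (e - e0)\<close> on the two sides of the
    prediction, \<open>F e\<close> has opposite weak signs, so the intermediate value theorem gives
    a root in between.\<close>
  have key: "\<exists>d>0. \<forall>e. norm (e - e0) < d \<longrightarrow> (\<exists>t\<in>Z e. \<bar>t - L e\<bar> \<le> \<eta> * norm (e - e0))" if "\<eta> > 0" for \<eta>
  proof -
    \<comment> \<open>Displacement of \<open>(e, t)\<close> relative to that of \<open>e\<close>: 1
      for \<open>e\<close> itself, \<open>K\<close> for the slope of \<open>L\<close>,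
      \<open>\<eta>\<close> for the offset from \<open>L e\<close>.\<close>
    define B where "B = 1 + K + \<eta>"
    have B: "B > 0" using K that by (simp add: B_def)
    then have "\<eta> / B > 0" using that by simp
    then obtain d where d: "d > 0" "\<And>s. norm (s - (e0, t0)) < d \<Longrightarrow>
        norm (F (fst s) (snd s) - F e0 t0 - (A (fst (s - (e0, t0))) + snd (s - (e0, t0)))) \<le> \<eta> / B * norm (s - (e0, t0))"
      using der unfolding has_derivative_at_alt by (metis fst_conv snd_conv)
    have near: "\<bar>F e (L e + \<sigma> * (\<eta> * norm (e - e0))) - \<sigma> * (\<eta> * norm (e - e0))\<bar> \<le> \<eta> * norm (e - e0)"
      if e: "norm (e - e0) < d / B" and \<sigma>: "\<bar>\<sigma>\<bar> = 1" for e \<sigma>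
    proof -
      let ?t = "L e + \<sigma> * (\<eta> * norm (e - e0))"
      have "norm ((e, ?t) - (e0, t0)) \<le> norm (e - e0) + \<bar>?t - t0\<bar>"
        using norm_Pair_le[of "e - e0" "?t - t0"] by simp
      also have "\<bar>?t - t0\<bar> \<le> \<bar>A (e - e0)\<bar> + \<bar>\<sigma> * (\<eta> * norm (e - e0))\<bar>"
        by (simp add: L_def)
      also have "\<bar>\<sigma> * (\<eta> * norm (e - e0))\<bar> = \<eta> * norm (e - e0)"
        using \<sigma> \<open>\<eta> > 0\<close> by (simp add: abs_mult)
      also have "norm (e - e0) + (\<bar>A (e - e0)\<bar> + \<eta> * norm (e - e0)) \<le> B * norm (e - e0)"
        using K(2)[of "e - e0"] by (simp add: B_def algebra_simps)
      finally have n: "norm ((e, ?t) - (e0, t0)) \<le> B * norm (e - e0)" by simp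
      also have "\<dots> < d" using e B by (simp add: field_simps)
      finally have "norm (F e ?t - F e0 t0 - (A (e - e0) + (?t - t0))) \<le> \<eta> / B * norm ((e, ?t) - (e0, t0))"
        using d(2)[of "(e, ?t)"] by simp
      also have "\<dots> \<le> \<eta> / B * (B * norm (e - e0))"
        using n B \<open>\<eta> > 0\<close> by (intro mult_left_mono) auto
      also have "\<dots> = \<eta> * norm (e - e0)" using B by simp
      also have "F e ?t - F e0 t0 - (A (e - e0) + (?t - t0)) = F e ?t - \<sigma> * (\<eta> * norm (e - e0))"
        by (simp add: F0 L_def)
      finally show ?thesis by simp
    qed
    have "\<exists>t\<in>Z e. \<bar>t - L e\<bar> \<le> \<eta> * norm (e - e0)" if e: "norm (e - e0) < d / B" for e
    proof -
      let ?h = "\<eta> * norm (e - e0)"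
      have "F e (L e - ?h) \<le> 0" "0 \<le> F e (L e + ?h)"
        using near[OF e, of "-1"] near[OF e, of 1] by auto
      moreover have "L e - ?h \<le> L e + ?h" using \<open>\<eta> > 0\<close> by simp
      ultimately obtain t where "L e - ?h \<le> t" "t \<le> L e + ?h" "F e t = 0"
        using IVT'[of "F e" "L e - ?h" 0 "L e + ?h"] continuous_on_subset[OF cont] by blast
      then show ?thesis by (intro bexI[of _ t]) (auto simp: Z_def)
    qed
    then show ?thesis using d(1) B by (intro exI[of _ "d / B"]) auto
  qed
  \<comment> \<open>Where \<open>Z e\<close> is empty this value is arbitrary; \<open>key\<close>
    excludes that near \<open>e0\<close>.\<close>
  define r where "r e = closest_point (Z e) (L e)" for e
  have L0: "L e0 = t0" by (simp add: L_def bounded_linear.linear[OF A] linear_0)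
  have r0: "r e0 = t0"
    unfolding r_def L0 by (rule closest_point_self) (simp add: Z_def F0)
  have "(r has_derivative (\<lambda>x. - A x)) (at e0)"
    unfolding has_derivative_at_alt
  proof (intro conjI allI impI)
    show "bounded_linear (\<lambda>x. - A x)" using A by (rule bounded_linear_minus)
  next
    fix \<eta> :: real assume "\<eta> > 0"
    then obtain d where d: "d > 0" "\<And>e. norm (e - e0) < d \<Longrightarrow> \<exists>t\<in>Z e. \<bar>t - L e\<bar> \<le> \<eta> * norm (e - e0)"
      using key by blast
    have "norm (r e - r e0 - - A (e - e0)) \<le> \<eta> * norm (e - e0)" if e: "norm (e - e0) < d" for e
    proof -
      obtain t where t: "t \<in> Z e" "\<bar>t - L e\<bar> \<le> \<eta> * norm (e - e0)" using d(2)[OF e] by blast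
      have "dist (L e) (r e) \<le> dist (L e) t"
        unfolding r_def by (rule closest_point_le[OF closed t(1)])
      then have "\<bar>r e - L e\<bar> \<le> \<eta> * norm (e - e0)"
        using t(2) by (simp add: dist_real_def abs_minus_commute)
      then show ?thesis by (simp add: r0 L_def)
    qed
    then show "\<exists>d>0. \<forall>e. norm (e - e0) < d \<longrightarrow> norm (r e - r e0 - - A (e - e0)) \<le> \<eta> * norm (e - e0)"
      using d(1) by blast
  qed
  moreover have "eventually (\<lambda>e. F e (r e) = 0) (nhds e0)"
  proof -
    obtain d where d: "d > 0" "\<And>e. norm (e - e0) < d \<Longrightarrow> Z e \<noteq> {}"
      using key[of 1] by fastforce
    have "F e (r e) = 0" if "dist e e0 < d" for e
      using closest_point_in_set[OF closed d(2)] that by (auto simp: dist_norm r_def Z_def)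
    then show ?thesis using d(1) unfolding eventually_nhds_metric by blast
  qed
  ultimately show thesis using r0 by (intro that[of r]) (auto simp: differentiable_def)
qed

text \<open>For an ultrafilter, the polynomials that vanish eventually form a prime ideal. Each further
  variable \<open>u\<close> is either free over this ideal, or satisfies an equation of minimal degree whose
  leading coefficient and derivative do not vanish eventually, so that \<open>u\<close> can be solved for as a
  simple root.\<close>
locale ultrafilter =
  fixes U :: "(real^'v::finite) filter"
  assumes ultra: "eventually Q U \<or> eventually (\<lambda>e. \<not> Q e) U"
begin

definition van :: "(real^'v \<Rightarrow> real) \<Rightarrow> bool" where
  "van f \<longleftrightarrow> eventually (\<lambda>e. f e = 0) U"

lemma not_van: "\<not> van f \<Longrightarrow> eventually (\<lambda>e. f e \<noteq> 0) U"
  using ultra[of "\<lambda>e. f e = 0"] by (auto simp: van_def)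

text \<open>Below degree \<open>m\<close> only trivial relations exist: the top coefficient vanishes
  eventually, and removing its monomial leaves a relation of smaller degree.\<close>

lemma van_coeff:
  assumes min: "\<And>D q. D < m \<Longrightarrow> q \<in> cpol V D \<Longrightarrow> van (\<lambda>e. poly (q e) (e $ u)) \<Longrightarrow> van (\<lambda>e. coeff (q e) D)"
    and "q \<in> cpol V D" "van (\<lambda>e. poly (q e) (e $ u))" "D < m"
  shows "van (\<lambda>e. coeff (q e) i)"
  using assms(2-)
proof (induction D arbitrary: q)
  case 0
  show ?case
  proof (cases i)
    case 0 then show ?thesis using min "0.prems" by blast
  next
    case (Suc j)
    then have "coeff (q e) i = 0" for e
      using "0.prems"(1) by (intro coeff_eq_0) (simp add: cpol_def)
    then show ?thesis by (simp add: van_def)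
  qed
next
  case (Suc D)
  have top: "van (\<lambda>e. coeff (q e) (Suc D))" using min Suc.prems by blast
  define q' where "q' e = q e - monom (coeff (q e) (Suc D)) (Suc D)" for e
  have coeff: "coeff (q' e) j = (if j = Suc D then 0 else coeff (q e) j)" for e j
    by (simp add: q'_def)
  have "degree (q' e) \<le> D" for e
  proof (rule degree_le, intro allI impI)
    fix j assume "D < j"
    show "coeff (q' e) j = 0"
    proof (cases "j = Suc D")
      case False
      then have "degree (q e) < j" using \<open>D < j\<close> Suc.prems(1)
        by (simp add: cpol_def) (metis Suc_lessI le_less_trans)
      then show ?thesis by (simp add: coeff coeff_eq_0)
    qed (simp add: coeff)
  qed
  moreover have "(\<lambda>e. coeff (q' e) j) \<in> pol V" for j
    using Suc.prems(1) unfolding coeff by (cases "j = Suc D") (simp_all add: cpol_def pol_const)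
  ultimately have q': "q' \<in> cpol V D" by (simp add: cpol_def)
  have "van (\<lambda>e. poly (q' e) (e $ u))"
    using Suc.prems(2) top unfolding van_def
    by eventually_elim (simp add: q'_def)
  then have "van (\<lambda>e. coeff (q' e) i)"
    using Suc.IH[OF q'] Suc.prems(3) by simp
  then show ?case using top by (cases "i = Suc D") (auto simp: coeff)
qed

text \<open>Pseudo-division by \<open>h\<close> lowers the degree bound of \<open>q\<close> until it
  is below \<open>m\<close>, where all coefficients vanish at \<open>p\<close>. Each step multiplies
  \<open>q\<close> by the leading coefficient of \<open>h\<close>, which can be cancelled at
  \<open>p\<close>.\<close>

lemma poly_vanishes_by_pseudo_division:
  assumes min: "\<And>D q. D < m \<Longrightarrow> q \<in> cpol V D \<Longrightarrow> van (\<lambda>e. poly (q e) (e $ u)) \<Longrightarrow> van (\<lambda>e. coeff (q e) D)"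
    and h: "h \<in> cpol V m" "van (\<lambda>e. poly (h e) (e $ u))" "m > 0"
    and p: "\<And>f. f \<in> pol V \<Longrightarrow> van f \<Longrightarrow> f p = 0" "poly (h p) (p $ u) = 0" "coeff (h p) m \<noteq> 0"
    and "q \<in> cpol V D" "van (\<lambda>e. poly (q e) (e $ u))"
  shows "poly (q p) (p $ u) = 0"
  using assms(8-)
proof (induction D arbitrary: q rule: less_induct)
  case (less D)
  show ?case
  proof (cases "D < m")
    case True
    have "coeff (q p) i = 0" for i
      using p(1)[of "\<lambda>e. coeff (q e) i"] van_coeff[OF min less.prems True] less.prems(1)
      by (simp add: cpol_def)
    then show ?thesis by (simp add: poly_altdef)
  next
    case False
    \<comment> \<open>The coefficients at \<open>D\<close> cancel, so \<open>D - 1\<close> bounds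
      the degree; this is a smaller bound because \<open>D \<ge> m > 0\<close>.\<close>
    define q' where "q' e = smult (coeff (h e) m) (q e) - monom (coeff (q e) D) (D - m) * h e" for e
    have coeff: "coeff (q' e) i = coeff (h e) m * coeff (q e) i -
        (if D - m \<le> i then coeff (q e) D * coeff (h e) (i - (D - m)) else 0)" for e i
      by (simp add: q'_def coeff_monom_mult)
    have "degree (q' e) \<le> D - 1" for e
    proof (rule degree_le, intro allI impI)
      fix i assume i: "D - 1 < i"
      show "coeff (q' e) i = 0"
      proof (cases "i = D")
        case True then show ?thesis using False by (simp add: coeff)
      next
        case i': False
        have "degree (q e) < i" "degree (h e) < i - (D - m)"
          using i i' False h(1,3) less.prems(1) by (auto simp: cpol_def intro: le_less_trans)
        then show ?thesis by (simp add: coeff coeff_eq_0)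
      qed
    qed
    moreover have "(\<lambda>e. coeff (q' e) i) \<in> pol V" for i
      using h(1) less.prems(1) unfolding coeff
      by (cases "D - m \<le> i") (simp_all add: cpol_def pol_diff pol_mult pol_const)
    ultimately have "q' \<in> cpol V (D - 1)" by (simp add: cpol_def)
    moreover have poly: "poly (q' e) x = coeff (h e) m * poly (q e) x - coeff (q e) D * x ^ (D - m) * poly (h e) x" for e x
      by (simp add: q'_def poly_monom)
    have "van (\<lambda>e. poly (q' e) (e $ u))"
      using less.prems(2) h(2) unfolding van_def
      by eventually_elim (simp add: poly)
    ultimately have "poly (q' p) (p $ u) = 0"
      using less.IH[of "D - 1" q'] False h(3) by simp
    then show ?thesis using p by (simp add: poly)
  qed
qed

text \<open>\<open>Z\<close> holds the free variables and \<open>S\<close> those already solved for.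
  The map \<open>w\<close> corrects only the latter so as to reach the common zeros of the ideal;
  variables still to be treated stay untouched.\<close>

definition has_local_section :: "'v set \<Rightarrow> 'v set \<Rightarrow> real^'v \<Rightarrow> bool" where
  "has_local_section Z S e0 \<longleftrightarrow> (\<exists>w. w e0 = e0 \<and> w differentiable (at e0) \<and> (\<forall>e. \<forall>v\<in>-S. w e $ v = e $ v) \<and>
     eventually (\<lambda>e. \<forall>f\<in>pol (Z \<union> S). van f \<longrightarrow> f (w e) = 0) (nhds e0))"

text \<open>After \<open>w\<close> has corrected the variables in \<open>S\<close>, the equation
  \<open>h = 0\<close> is solved for \<open>u\<close> as a simple root. The leading coefficient of
  \<open>h\<close> stays nonzero near \<open>e0\<close>, so pseudo-division carries all other
  relations along.\<close>

lemma has_local_section_insert: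
  assumes u: "u \<notin> Z \<union> S"
    and min: "\<And>D q. D < m \<Longrightarrow> q \<in> cpol (Z \<union> S) D \<Longrightarrow> van (\<lambda>e. poly (q e) (e $ u)) \<Longrightarrow> van (\<lambda>e. coeff (q e) D)"
    and h: "h \<in> cpol (Z \<union> S) m" "van (\<lambda>e. poly (h e) (e $ u))" "m > 0"
    and e0: "poly (h e0) (e0 $ u) = 0" "coeff (h e0) m \<noteq> 0" "poly (pderiv (h e0)) (e0 $ u) \<noteq> 0"
    and sec: "has_local_section Z S e0"
  shows "has_local_section Z (insert u S) e0"
proof -
  let ?V = "Z \<union> S"
  obtain w where w: "w e0 = e0" "w differentiable (at e0)" "\<And>e v. v \<notin> S \<Longrightarrow> w e $ v = e $ v"
    and wvan: "eventually (\<lambda>e. \<forall>f\<in>pol ?V. van f \<longrightarrow> f (w e) = 0) (nhds e0)"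
    using sec unfolding has_local_section_def by auto
  define c where "c = poly (pderiv (h e0)) (e0 $ u)"
  define upd :: "real^'v \<Rightarrow> real \<Rightarrow> real^'v" where "upd e t = e + (t - e $ u) *\<^sub>R axis u 1" for e t
  have upd_u: "upd e t $ u = t" for e t by (simp add: upd_def)
  have upd_v: "upd e t $ v = e $ v" if "v \<noteq> u" for e t v using that by (simp add: upd_def axis_def)
  have pol_upd: "f (upd e t) = f e" if "f \<in> pol ?V" for f e t
    using that u by (intro pol_cong[OF that]) (auto intro!: upd_v)
  have h_upd: "h (upd e t) = h e" for e t
    using h(1) pol_upd[of "\<lambda>e. coeff (h e) _"] by (intro poly_eqI) (simp add: cpol_def)
  define H where "H e = poly (h e) (e $ u)" for e
  have "real_polynomial_function H"
    unfolding H_def by (rule pol_real_polynomial_function[OF cpol_poly_pol[OF h(1)]])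
  then obtain H' where H': "(H has_derivative H') (at e0)"
    using differentiable_at_real_polynomial_function unfolding differentiable_def by blast
  then have "linear H'" by (rule has_derivative_linear)
  obtain w' where w': "(w has_derivative w') (at e0)" using w(2) unfolding differentiable_def by blast
  then have blw: "bounded_linear w'" by (rule has_derivative_bounded_linear)
  \<comment> \<open>The coefficients of \<open>h\<close> do not involve \<open>u\<close>, so the
    partial derivative of \<open>H\<close> in \<open>u\<close> is that of a univariate
    polynomial.\<close>
  have H'u: "H' (axis u 1) = c"
  proof -
    have "((\<lambda>t. H (e0 + t *\<^sub>R axis u 1)) has_derivative (\<lambda>t. H' (t *\<^sub>R axis u 1))) (at 0)"
      by (rule has_derivative_compose[where g = H and f = "\<lambda>t. e0 + t *\<^sub>R axis u 1"])
        (auto intro!: derivative_eq_intros simp: H')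
    then have "((\<lambda>t. H (e0 + t *\<^sub>R axis u 1)) has_real_derivative H' (axis u 1)) (at 0)"
      by (simp add: has_field_derivative_def linear_scale[OF \<open>linear H'\<close>] mult_commute_abs)
    moreover have "H (e0 + t *\<^sub>R axis u 1) = poly (h e0) (e0 $ u + t)" for t
      using h_upd[of e0 "e0 $ u + t"] upd_u[of e0 "e0 $ u + t"] by (simp add: upd_def H_def)
    moreover have "((\<lambda>t. poly (h e0) (e0 $ u + t)) has_real_derivative c) (at 0)"
      unfolding c_def by (rule DERIV_chain2[where g = "\<lambda>t. e0 $ u + t" and Db = 1, simplified])
        (auto intro!: derivative_eq_intros poly_DERIV)
    ultimately show ?thesis by (simp add: DERIV_unique)
  qed
  \<comment> \<open>Division by \<open>c\<close> normalises the derivative in \<open>t\<close> to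
    1.\<close>
  define F where "F e t = H (upd (w e) t) / c" for e t
  have F: "F e t = poly (h (w e)) t / c" for e t by (simp add: F_def H_def h_upd upd_u)
  \<comment> \<open>The last term appears because \<open>upd\<close> overwrites the coordinate
    \<open>u\<close> of \<open>w e\<close>.\<close>
  define A where "A \<epsilon> = H' (w' \<epsilon>) / c - w' \<epsilon> $ u" for \<epsilon>
  have upd0: "upd (w e0) (e0 $ u) = e0" by (simp add: w upd_def)
  have "((\<lambda>s. upd (w (fst s)) (snd s)) has_derivative
      (\<lambda>s. w' (fst s) + (snd s - w' (fst s) $ u) *\<^sub>R axis u 1)) (at (e0, e0 $ u))"
  proof -
    have 1: "((\<lambda>s. w (fst s)) has_derivative (\<lambda>s. w' (fst s))) (at (e0, e0 $ u))"
      by (rule has_derivative_compose[where f = fst and g = w]) (auto intro!: derivative_eq_intros w')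
    show ?thesis unfolding upd_def
      by (rule derivative_eq_intros 1 bounded_linear.has_derivative[OF bounded_linear_vec_nth 1] refl | simp)+
  qed
  then have "((\<lambda>s. H (upd (w (fst s)) (snd s))) has_derivative
      (\<lambda>s. H' (w' (fst s) + (snd s - w' (fst s) $ u) *\<^sub>R axis u 1))) (at (e0, e0 $ u))"
    by (rule has_derivative_compose) (simp add: upd0 H')
  then have "((\<lambda>s. F (fst s) (snd s)) has_derivative
      (\<lambda>s. H' (w' (fst s) + (snd s - w' (fst s) $ u) *\<^sub>R axis u 1) / c)) (at (e0, e0 $ u))"
    unfolding F_def using has_derivative_mult_left[where y = "1/c"] by fastforce
  moreover have "H' (w' \<epsilon> + (\<tau> - w' \<epsilon> $ u) *\<^sub>R axis u 1) / c = A \<epsilon> + \<tau>" for \<epsilon> \<tau>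
  proof -
    have "H' (w' \<epsilon> + (\<tau> - w' \<epsilon> $ u) *\<^sub>R axis u 1) = H' (w' \<epsilon>) + (\<tau> - w' \<epsilon> $ u) * c"
      using \<open>linear H'\<close> by (simp only: linear_add linear_scale H'u real_scaleR_def)
    then show ?thesis using e0(3) by (simp add: A_def field_simps flip: c_def)
  qed
  ultimately have der: "((\<lambda>s. F (fst s) (snd s)) has_derivative (\<lambda>s. A (fst s) + snd s)) (at (e0, e0 $ u))"
    by simp
  have blA: "bounded_linear A"
    unfolding A_def
    by (rule bounded_linear_sub[OF bounded_linear_compose[OF bounded_linear_divide
          bounded_linear_compose[OF has_derivative_bounded_linear[OF H'] blw]]
          bounded_linear_compose[OF bounded_linear_vec_nth blw]])
  have cont: "continuous_on UNIV (F e)" for e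
  proof -
    have "F e = (\<lambda>t. poly (h (w e)) t / c)" by (auto simp: F)
    then show ?thesis by (simp add: divide_inverse continuous_intros)
  qed
  obtain r where r: "r e0 = e0 $ u" "r differentiable (at e0)" "eventually (\<lambda>e. F e (r e) = 0) (nhds e0)"
    using differentiable_root_function[OF _ der cont blA] e0(1) by (auto simp: F w)
  define w2 where "w2 e = upd (w e) (r e)" for e
  have "w2 e0 = e0" by (simp add: w2_def r upd0)
  moreover have "w2 differentiable (at e0)"
  proof -
    obtain r' where "(r has_derivative r') (at e0)" using r(2) unfolding differentiable_def by blast
    note * = has_derivative_add[OF w' has_derivative_scaleR_left[OF has_derivative_diff[OF this
      bounded_linear.has_derivative[OF bounded_linear_vec_nth w']]]]
    show ?thesis unfolding w2_def upd_def differentiable_def using * by blast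
  qed
  moreover have "w2 e $ v = e $ v" if "v \<notin> insert u S" for e v
    using that w(3) by (simp add: w2_def upd_v)
  moreover have "eventually (\<lambda>e. \<forall>f\<in>pol (Z \<union> insert u S). van f \<longrightarrow> f (w2 e) = 0) (nhds e0)"
  proof -
    have "eventually (\<lambda>e. coeff (h (w e)) m \<noteq> 0) (nhds e0)"
    proof -
      have "real_polynomial_function (\<lambda>e. coeff (h e) m)"
        using h(1) by (intro pol_real_polynomial_function) (auto simp: cpol_def)
      then have "isCont (\<lambda>e. coeff (h e) m) (w e0)"
        using continuous_real_polymonial_function by blast
      then have "isCont (\<lambda>e. coeff (h (w e)) m) e0"
        using isCont_o2[OF differentiable_imp_continuous_within[OF w(2)]] by blast
      then have "eventually (\<lambda>e. coeff (h (w e)) m \<noteq> 0) (at e0)"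
        using e0(2) w(1) unfolding isCont_def by (metis tendsto_imp_eventually_ne)
      then show ?thesis using e0(2) w(1) by (simp add: eventually_nhds_conv_at)
    qed
    with wvan r(3) show ?thesis
    proof eventually_elim
      case (elim e)
      show ?case
      proof (intro ballI impI)
        fix f assume "f \<in> pol (Z \<union> insert u S)" "van f"
        then obtain D q where q: "q \<in> cpol ?V D" "\<And>e. f e = poly (q e) (e $ u)"
          using pol_insert_cpol[of f u ?V] by auto
        have "poly (q (w2 e)) (w2 e $ u) = 0"
        proof (rule poly_vanishes_by_pseudo_division[OF min h _ _ _ q(1)])
          show "g (w2 e) = 0" if "g \<in> pol ?V" "van g" for g
            using elim(1) that pol_upd[OF that(1)] by (simp add: w2_def)
          show "poly (h (w2 e)) (w2 e $ u) = 0"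
            using elim e0(3) by (simp add: w2_def h_upd upd_u F c_def)
          show "coeff (h (w2 e)) m \<noteq> 0" using elim by (simp add: w2_def h_upd)
          show "van (\<lambda>e. poly (q e) (e $ u))" using \<open>van f\<close> by (simp flip: q(2))
        qed
        then show "f (w2 e) = 0" by (simp add: q(2))
      qed
    qed
  qed
  ultimately show ?thesis unfolding has_local_section_def by blast
qed

lemma eventually_has_local_section:
  assumes "finite S" "S \<inter> Z = {}" and Z: "\<And>f e. f \<in> pol Z \<Longrightarrow> van f \<Longrightarrow> f e = 0"
  shows "eventually (has_local_section Z S) U"
  using assms(1,2)
proof (induction S rule: finite_induct)
  case empty
  have "has_local_section Z {} e" for e
    unfolding has_local_section_def by (intro exI[of _ "\<lambda>e. e"]) (simp add: Z)
  then show ?case by simp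
next
  case (insert u S)
  then have u: "u \<notin> Z \<union> S" and IH: "eventually (has_local_section Z S) U" by auto
  let ?bad = "\<lambda>D. \<exists>q\<in>cpol (Z \<union> S) D. van (\<lambda>e. poly (q e) (e $ u)) \<and> \<not> van (\<lambda>e. coeff (q e) D)"
  show ?case
  proof (cases "\<exists>D. ?bad D")
    \<comment> \<open>Here \<open>u\<close> is free: every relation has eventually vanishing
      coefficients, so the old section also serves the larger set of variables.\<close>
    case False
    have "f p = 0" if p: "\<forall>f\<in>pol (Z \<union> S). van f \<longrightarrow> f p = 0" and f: "f \<in> pol (Z \<union> insert u S)" "van f" for f p
    proof -
      obtain D q where q: "q \<in> cpol (Z \<union> S) D" "\<And>e. f e = poly (q e) (e $ u)"
        using pol_insert_cpol[of f u "Z \<union> S"] f by auto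
      have "van (\<lambda>e. coeff (q e) i)" for i
        by (rule van_coeff[where m = "Suc D", OF _ q(1)]) (use False f(2) in \<open>auto simp: q(2)[symmetric]\<close>)
      then have "coeff (q p) i = 0" for i
        using bspec[OF p, of "\<lambda>e. coeff (q e) i"] q(1) by (simp add: cpol_def)
      then show ?thesis by (simp add: q(2) poly_altdef)
    qed
    then have "has_local_section Z (insert u S) e" if "has_local_section Z S e" for e
      using that unfolding has_local_section_def by (elim exE, intro exI) (auto elim: eventually_mono)
    then show ?thesis using IH by (auto elim: eventually_mono)
  next
    case True
    define m where "m = (LEAST D. ?bad D)"
    obtain h where h: "h \<in> cpol (Z \<union> S) m" "van (\<lambda>e. poly (h e) (e $ u))" "\<not> van (\<lambda>e. coeff (h e) m)"
      using LeastI_ex[OF True] unfolding m_def by blast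
    have min: "van (\<lambda>e. coeff (q e) D)" if "D < m" "q \<in> cpol (Z \<union> S) D" "van (\<lambda>e. poly (q e) (e $ u))" for D q
      using not_less_Least[of D ?bad] that unfolding m_def by blast
    \<comment> \<open>A relation of degree 0 is its own leading coefficient.\<close>
    have "m \<noteq> 0"
    proof
      assume "m = 0"
      then have "degree (h e) = 0" for e using h(1) by (simp add: cpol_def)
      then have "poly (h e) x = coeff (h e) 0" for e x
        by (simp add: poly_altdef)
      then show False using h(2,3) \<open>m = 0\<close> by simp
    qed
    then obtain k where k: "m = Suc k" by (cases m) auto
    \<comment> \<open>The derivative has degree bound below \<open>m\<close>, and its coefficient
      there is \<open>m\<close> times the leading coefficient of \<open>h\<close>; vanishing would
      contradict minimality.\<close>
    have "\<not> van (\<lambda>e. poly (pderiv (h e)) (e $ u))"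
    proof
      assume "van (\<lambda>e. poly (pderiv (h e)) (e $ u))"
      then have "van (\<lambda>e. coeff (pderiv (h e)) k)"
        using min[of k "\<lambda>e. pderiv (h e)"] cpol_pderiv h(1) k by blast
      then show False using h(3) by (simp add: coeff_pderiv k van_def del: of_nat_Suc)
    qed
    from not_van[OF this] not_van[OF h(3)] h(2)[unfolded van_def] IH show ?thesis
    proof eventually_elim
      case (elim e)
      show ?case
        by (rule has_local_section_insert[OF u min h(1,2)]) (use elim k in auto)
    qed
  qed
qed

end

text \<open>The parts of \<open>W\<close> where a given nonzero polynomial in \<open>Z\<close> does
  not vanish generate a proper filter. Along an ultrafilter refining it no nonzero polynomial in
  \<open>Z\<close> vanishes eventually, whereas every equation valid on \<open>W\<close> does hold
  eventually.\<close>

theorem local_section_if_dense: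
  fixes W :: "(real^'v::finite) set"
  assumes dense: "\<And>P. P \<in> pol Z \<Longrightarrow> (\<And>e. e \<in> W \<Longrightarrow> P e = 0) \<Longrightarrow> P = (\<lambda>e. 0)"
  obtains e0 w where "e0 \<in> W" "w e0 = e0" "w differentiable (at e0)" "\<And>e v. v \<in> Z \<Longrightarrow> w e $ v = e $ v"
    "eventually (\<lambda>e. \<forall>f\<in>pol UNIV. (\<forall>e\<in>W. f e = 0) \<longrightarrow> f (w e) = 0) (nhds e0)"
proof -
  define B where "B = pol Z - {\<lambda>e. 0}"
  define F where "F = (INF P\<in>B. principal {e\<in>W. P e \<noteq> 0})"
  have B1: "(\<lambda>e. 1) \<in> B" by (auto simp: B_def pol_const dest: fun_cong)
  have F: "eventually Q F \<longleftrightarrow> (\<exists>P\<in>B. \<forall>e\<in>W. P e \<noteq> 0 \<longrightarrow> Q e)" for Q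
  proof -
    have "eventually Q F \<longleftrightarrow> (\<exists>P\<in>B. eventually Q (principal {e\<in>W. P e \<noteq> 0}))"
      unfolding F_def
    proof (rule eventually_INF_base)
      show "B \<noteq> {}" using B1 by auto
    next
      fix P Q assume PQ: "P \<in> B" "Q \<in> B"
      have "(\<lambda>e. P e * Q e) \<in> B"
      proof -
        have "(\<lambda>e. P e * Q e) \<noteq> (\<lambda>e. 0)"
        proof
          assume eq: "(\<lambda>e. P e * Q e) = (\<lambda>e. 0)"
          obtain a where "P a \<noteq> 0" using PQ(1) by (auto simp: B_def)
          then have "Q e = 0" for e
            using pol_mult_eq_0[of P Z Q a e] PQ fun_cong[OF eq] by (auto simp: B_def)
          then show False using PQ(2) by (auto simp: B_def)
        qed
        then show ?thesis using PQ by (auto simp: B_def pol_mult)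
      qed
      then show "\<exists>x\<in>B. principal {e\<in>W. x e \<noteq> 0} \<le> inf (principal {e\<in>W. P e \<noteq> 0}) (principal {e\<in>W. Q e \<noteq> 0})"
        by (rule bexI[rotated]) auto
    qed
    then show ?thesis by (auto simp: eventually_principal)
  qed
  have "F \<noteq> bot"
    using dense by (auto simp: trivial_limit_def F B_def)
  then obtain U where U: "U \<le> F" "U \<noteq> bot" "\<And>Q. eventually Q U \<or> eventually (\<lambda>x. \<not> Q x) U"
    using ultrafilter_exists by blast
  interpret ultrafilter U using U(3) by unfold_locales
  have "f e = 0" if f: "f \<in> pol Z" "van f" for f e
  proof (rule ccontr)
    assume "f e \<noteq> 0"
    then have "f \<in> B" using f by (auto simp: B_def)
    then have "eventually (\<lambda>e. f e \<noteq> 0) U" using U(1) F filter_leD by blast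
    with f(2) have "eventually (\<lambda>e. False) U" unfolding van_def by eventually_elim simp
    then show False using U(2) by (simp add: trivial_limit_def)
  qed
  then have "eventually (has_local_section Z (- Z)) U"
    by (intro eventually_has_local_section) auto
  moreover have W: "eventually (\<lambda>e. e \<in> W) U" using U(1) F B1 filter_leD by blast
  ultimately have "eventually (\<lambda>e. e \<in> W \<and> has_local_section Z (- Z) e) U"
    by eventually_elim simp
  then obtain e0 where e0: "e0 \<in> W" "has_local_section Z (- Z) e0"
    using U(2) eventually_happens by blast
  have "van f" if "\<forall>e\<in>W. f e = 0" for f
    using W unfolding van_def by eventually_elim (use that in simp)
  moreover obtain w where w: "w e0 = e0" "w differentiable (at e0)" "\<And>e v. v \<in> Z \<Longrightarrow> w e $ v = e $ v"
    and wvan: "eventually (\<lambda>e. \<forall>f\<in>pol (Z \<union> - Z). van f \<longrightarrow> f (w e) = 0) (nhds e0)"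
    using e0(2) unfolding has_local_section_def by auto
  ultimately have "eventually (\<lambda>e. \<forall>f\<in>pol UNIV. (\<forall>e\<in>W. f e = 0) \<longrightarrow> f (w e) = 0) (nhds e0)"
    by (auto elim!: eventually_mono)
  then show thesis using that[of e0 w] e0(1) w by blast
qed

section \<open>Generic sets, orbits and max filters\<close>

text \<open>A map of full rank is bijective, so an open part of the image of \<open>E\<close> would
  pull back to an open part of \<open>E\<close>.\<close>

lemma sa_dim_less_if_interior_empty:
  fixes E :: "'a::euclidean_space set"
  assumes "interior E = {}"
  shows "sa_dim E < int DIM('a)"
proof (cases "E = {}")
  case False
  let ?R = "\<lambda>k. \<exists>f::'a \<Rightarrow> 'a. linear f \<and> dim (range f) = k \<and>
      (\<exists>U. openin (top_of_set (range f)) U \<and> U \<noteq> {} \<and> U \<subseteq> f ` E)"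
  \<comment> \<open>The zero map makes rank 0 admissible, and ranks are bounded, so
    \<open>GREATEST\<close> is attained.\<close>
  have "?R 0"
  proof (intro exI[of _ "\<lambda>x. 0"] conjI exI[of _ "{0}"])
    show "openin (top_of_set (range (\<lambda>x::'a. 0::'a))) {0}" by auto
  qed (use False in \<open>auto simp: linear_zero\<close>)
  moreover have "\<forall>k. ?R k \<longrightarrow> k \<le> DIM('a)"
    by (metis dim_subset_UNIV)
  ultimately have "?R (Greatest ?R)" using GreatestI_nat[of ?R 0 "DIM('a)"] by blast
  then obtain f U where f: "linear (f::'a \<Rightarrow> 'a)" "dim (range f) = Greatest ?R"
    and U: "openin (top_of_set (range f)) U" "U \<noteq> {}" "U \<subseteq> f ` E" by blast
  have "dim (range f) \<noteq> DIM('a)"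
  proof
    assume "dim (range f) = DIM('a)"
    then have surj: "surj f"
      using f(1) by (metis dim_eq_full linear_subspace_image span_eq_iff subspace_UNIV)
    then have "inj f" using f(1) by (simp add: linear_surjective_imp_injective)
    have "open (f -` U)"
      using U(1) surj f(1) by (intro open_vimage) (auto intro: linear_continuous_on linear_conv_bounded_linear[THEN iffD1])
    moreover have "f -` U \<subseteq> E" using U(3) \<open>inj f\<close> by (auto dest: injD)
    moreover have "f -` U \<noteq> {}" using U(2) surj by (metis surj_image_vimage_eq image_empty)
    ultimately show False using assms interior_maximal by blast
  qed
  then have "dim (range f) < DIM('a)" using dim_subset_UNIV[of "range f"] by linarith
  then show ?thesis using False f(2) by (simp add: sa_dim_def)
qed (simp add: sa_dim_def)

lemma polyfun_real_polynomial_function: "P \<in> polyfun \<Longrightarrow> real_polynomial_function P"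
  by (induction rule: polyfun.induct) (auto simp: bounded_linear_inner_left)

lemma generic_if_polyfun:
  assumes P: "P \<in> polyfun" "P a \<noteq> 0" and Q: "\<And>z. P z \<noteq> 0 \<Longrightarrow> Q z"
  shows "generic Q"
proof -
  have "interior {z. P z = 0} = {}"
  proof (rule ccontr)
    assume "interior {z. P z = 0} \<noteq> {}"
    then obtain b where "b \<in> interior {z. P z = 0}" by blast
    then have "P a = 0"
      using real_polynomial_function_eq_0_if_open[OF polyfun_real_polynomial_function[OF P(1)] open_interior]
        interior_subset by blast
    then show False using P(2) by simp
  qed
  then show ?thesis
    unfolding generic_def using P(1) Q sa_dim_less_if_interior_empty
    by (intro exI[of _ "{z. P z = 0}"]) (auto intro: sa_eq)
qed

section \<open>Orbits and the quotient topology\<close>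

lemma orth_group_inv_mem:
  assumes "orth_group G" "g \<in> G"
  shows "inv g \<in> G" "g (inv g x) = x" "inv g (g x) = x"
proof -
  have "orthogonal_transformation g" using assms unfolding orth_group_def by blast
  then have "bij g" by (rule orthogonal_transformation_bij)
  then show "g (inv g x) = x" "inv g (g x) = x"
    by (simp_all add: bij_is_surj bij_is_inj surj_f_inv_f)
  show "inv g \<in> G" using assms unfolding orth_group_def by blast
qed

lemma orbit_self: "orth_group G \<Longrightarrow> x \<in> orbit G x"
  unfolding orth_group_def orbit_def by (metis id_apply image_eqI)

lemma orbit_mem_closed:
  assumes "orth_group G" "g \<in> G" "y \<in> orbit G x"
  shows "g y \<in> orbit G x"
proof -
  obtain h where "h \<in> G" "y = h x" using assms by (auto simp: orbit_def)
  moreover have "g \<circ> h \<in> G" using assms \<open>h \<in> G\<close> by (simp add: orth_group_def)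
  ultimately show ?thesis unfolding orbit_def by (metis comp_apply image_eqI)
qed

lemma orbit_eq_if_mem:
  assumes G: "orth_group G" and y: "y \<in> orbit G x"
  shows "orbit G y = orbit G x"
proof
  show "orbit G y \<subseteq> orbit G x"
    using orbit_mem_closed[OF G _ y] by (auto simp: orbit_def)
  obtain g where g: "g \<in> G" "y = g x" using y by (auto simp: orbit_def)
  then have "x \<in> orbit G y"
    using orth_group_inv_mem[OF G g(1)] by (metis imageI orbit_def)
  then show "orbit G x \<subseteq> orbit G y"
    using orbit_mem_closed[OF G] by (auto simp: orbit_def)
qed

lemma orbit_eq_iff: "orth_group G \<Longrightarrow> orbit G y = orbit G x \<longleftrightarrow> y \<in> orbit G x"
  using orbit_eq_if_mem orbit_self by metis

lemma orth_group_linear: "orth_group G \<Longrightarrow> g \<in> G \<Longrightarrow> linear g"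
  unfolding orth_group_def orthogonal_transformation_def by blast

lemma orth_group_norm: "orth_group G \<Longrightarrow> g \<in> G \<Longrightarrow> norm (g x) = norm x"
  unfolding orth_group_def orthogonal_transformation by blast

lemma orth_group_inner: "orth_group G \<Longrightarrow> g \<in> G \<Longrightarrow> g x \<bullet> g y = x \<bullet> y"
  unfolding orth_group_def orthogonal_transformation_def by blast

lemma orbit_scaleR_mem:
  assumes "orth_group G" "p \<in> orbit G x"
  shows "s *\<^sub>R p \<in> orbit G (s *\<^sub>R x)"
proof -
  obtain g where g: "g \<in> G" "p = g x" using assms(2) by (auto simp: orbit_def)
  then have "s *\<^sub>R p = g (s *\<^sub>R x)" using orth_group_linear[OF assms(1)] by (simp add: linear_scale)
  then show ?thesis using g(1) by (simp add: orbit_def)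
qed

lemma orbit_space_disjoint:
  assumes "orth_group G" "A \<in> orbit_space G" "B \<in> orbit_space G" "x \<in> A" "x \<in> B"
  shows "A = B"
proof -
  obtain a b where "A = orbit G a" "B = orbit G b" using assms by (auto simp: orbit_space_def)
  then show ?thesis using orbit_eq_if_mem[OF assms(1)] assms(4,5) by metis
qed

text \<open>Orbits are disjoint, so the union of an intersection of families is the intersection of
  their unions; this makes the defining predicate a topology.\<close>

lemma openin_quotient_top:
  assumes G: "orth_group G"
  shows "openin (quotient_top G) U \<longleftrightarrow> U \<subseteq> orbit_space G \<and> open (\<Union>U)"
proof -
  have "istopology (\<lambda>U. U \<subseteq> orbit_space G \<and> open (\<Union>U))"
    unfolding istopology_def
  proof (intro conjI allI impI)
    fix S T assume S: "S \<subseteq> orbit_space G \<and> open (\<Union>S)" and T: "T \<subseteq> orbit_space G \<and> open (\<Union>T)"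
    have "\<Union>(S \<inter> T) = \<Union>S \<inter> \<Union>T"
      using S T orbit_space_disjoint[OF G] by blast
    then show "open (\<Union>(S \<inter> T))" using S T by auto
    show "S \<inter> T \<subseteq> orbit_space G" using S by auto
  next
    fix K assume "\<forall>S\<in>K. S \<subseteq> orbit_space G \<and> open (\<Union>S)"
    moreover have "\<Union>(\<Union>K) = (\<Union>S\<in>K. \<Union>S)" by auto
    ultimately show "\<Union>K \<subseteq> orbit_space G" "open (\<Union>(\<Union>K))" by auto
  qed
  then show ?thesis by (simp add: quotient_top_def topology_inverse')
qed

text \<open>Points of \<open>X\<close> are closed, and by injectivity the preimage of the value at
  \<open>[x]\<close> is the single orbit, whose complement is the union of the other orbits.\<close>

lemma closed_orbit_if_injective:
  assumes G: "orth_group G" and X: "t1_space X" and h: "continuous_map (quotient_top G) X h"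
    and inj: "inj_on h (orbit_space G)"
  shows "closed (orbit G x)"
proof -
  have Un: "\<Union>(orbit_space G) = UNIV"
    using orbit_self[OF G] by (auto simp: orbit_space_def)
  have top: "topspace (quotient_top G) = orbit_space G"
  proof
    show "topspace (quotient_top G) \<subseteq> orbit_space G"
      using openin_topspace[of "quotient_top G"] by (simp only: openin_quotient_top[OF G])
    show "orbit_space G \<subseteq> topspace (quotient_top G)"
      by (rule openin_subset) (simp add: openin_quotient_top[OF G] Un)
  qed
  have mem: "orbit G x \<in> orbit_space G" by (simp add: orbit_space_def)
  then have "h (orbit G x) \<in> topspace X"
    using continuous_map_funspace[OF h] top by auto
  then have "closedin X {h (orbit G x)}" using X by (simp add: t1_space_closedin_singleton)
  then have "closedin (quotient_top G) {A \<in> orbit_space G. h A \<in> {h (orbit G x)}}"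
    using closedin_continuous_map_preimage[OF h] unfolding top by blast
  moreover have "{A \<in> orbit_space G. h A \<in> {h (orbit G x)}} = {orbit G x}"
    using inj mem by (auto dest: inj_onD)
  ultimately have "openin (quotient_top G) (orbit_space G - {orbit G x})"
    by (simp add: closedin_def top)
  then have "open (\<Union>(orbit_space G - {orbit G x}))" by (simp add: openin_quotient_top[OF G])
  moreover have "\<Union>(orbit_space G - {orbit G x}) = - orbit G x"
  proof -
    have "y \<in> \<Union>(orbit_space G - {orbit G x})" if "y \<notin> orbit G x" for y
      using that orbit_self[OF G, of y] by (auto simp: orbit_space_def)
    moreover have "y \<notin> orbit G x" if "y \<in> \<Union>(orbit_space G - {orbit G x})" for y
      using that orbit_space_disjoint[OF G _ mem] by blast
    ultimately show ?thesis by blast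
  qed
  ultimately show ?thesis by (simp add: closed_def)
qed

section \<open>Max filters and their maximisers\<close>

lemma maxfilt_spheres:
  fixes z x :: "'a::real_inner"
  assumes "z \<noteq> 0"
  shows "maxfilt (sphere (0::'a) (norm z)) (sphere 0 (norm x)) = norm z * norm x"
  unfolding maxfilt_def
proof (rule cSup_eq_maximum)
  have "norm z * norm x = z \<bullet> ((norm x / norm z) *\<^sub>R z)" "(norm x / norm z) *\<^sub>R z \<in> sphere 0 (norm x)"
    using assms by (simp_all add: dot_square_norm power2_eq_square)
  moreover have "z \<in> sphere (0::'a) (norm z)" by simp
  ultimately show "norm z * norm x \<in> {p \<bullet> q |p q. p \<in> sphere (0::'a) (norm z) \<and> q \<in> sphere 0 (norm x)}"
    by blast
next
  fix r assume "r \<in> {p \<bullet> q |p q. p \<in> sphere (0::'a) (norm z) \<and> q \<in> sphere 0 (norm x)}"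
  then obtain p q :: 'a where "r = p \<bullet> q" "norm p = norm z" "norm q = norm x" by auto
  then show "r \<le> norm z * norm x" using norm_cauchy_schwarz[of p q] by simp
qed

lemma bounded_orbit: "orth_group G \<Longrightarrow> bounded (orbit G x)"
  unfolding bounded_iff orbit_def using orth_group_norm[of G] by (metis imageE order_refl)

text \<open>Moving \<open>g\<close> to the other factor as its inverse leaves a supremum over one
  compact orbit.\<close>

lemma maxfilt_orbit_attained:
  fixes x :: "'a::euclidean_space"
  assumes G: "orth_group G" and "closed (orbit G x)"
  obtains p where "p \<in> orbit G x" "maxfilt (orbit G z) (orbit G x) = z \<bullet> p"
    "\<And>p'. p' \<in> orbit G x \<Longrightarrow> z \<bullet> p' \<le> z \<bullet> p"
proof -
  have "compact (orbit G x)" using assms bounded_orbit[OF G] by (simp add: compact_eq_bounded_closed)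
  moreover have "orbit G x \<noteq> {}" using orbit_self[OF G] by blast
  ultimately obtain p where p: "p \<in> orbit G x" "\<And>p'. p' \<in> orbit G x \<Longrightarrow> z \<bullet> p' \<le> z \<bullet> p"
    using continuous_attains_sup[of "orbit G x" "\<lambda>p. z \<bullet> p"]
      continuous_on_inner[OF continuous_on_const continuous_on_id] by blast
  have "maxfilt (orbit G z) (orbit G x) = z \<bullet> p"
    unfolding maxfilt_def
  proof (rule cSup_eq_maximum)
    show "z \<bullet> p \<in> {a \<bullet> b |a b. a \<in> orbit G z \<and> b \<in> orbit G x}"
      using p(1) orbit_self[OF G] by blast
  next
    fix r assume "r \<in> {a \<bullet> b |a b. a \<in> orbit G z \<and> b \<in> orbit G x}"
    then obtain g b where gb: "r = g z \<bullet> b" "g \<in> G" "b \<in> orbit G x" by (auto simp: orbit_def)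
    then have "r = z \<bullet> inv g b"
      using orth_group_inner[OF G, of "inv g" "g z" b] orth_group_inv_mem[OF G gb(2)] by simp
    then show "r \<le> z \<bullet> p"
      using p(2) orbit_mem_closed[OF G _ gb(3)] orth_group_inv_mem(1)[OF G gb(2)] by simp
  qed
  then show thesis using that p by blast
qed

text \<open>Orbit membership becomes a system of polynomial equations, which a local section
  preserves.\<close>

lemma mem_orbit_if_invariants_agree:
  fixes x :: "real^'d"
  assumes G: "orth_group G" and cl: "\<And>x. closed (orbit G x)"
    and agree: "\<And>k c. (\<And>g u. g \<in> G \<Longrightarrow> tform k c (homog (g u)) = tform k c (homog u)) \<Longrightarrow>
      tform k c (homog p) = tform k c (homog x)"
  shows "p \<in> orbit G x"
proof (rule ccontr)
  assume "p \<notin> orbit G x"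
  then have "orbit G p \<inter> orbit G x = {}"
    using orbit_eq_if_mem[OF G] orbit_self[OF G] by blast
  moreover have "compact (orbit G y)" for y
    using cl bounded_orbit[OF G] by (simp add: compact_eq_bounded_closed)
  moreover have "G \<subseteq> {g. orthogonal_transformation g}" using G by (simp add: orth_group_def)
  ultimately obtain k c where
    "\<And>g u. g \<in> G \<Longrightarrow> tform k c (homog (g u)) = tform k c (homog u)"
    "\<And>u v. u \<in> orbit G p \<Longrightarrow> v \<in> orbit G x \<Longrightarrow> tform k c (homog u) < tform k c (homog v)"
    using invariant_tform_separates[of G "orbit G p" "orbit G x"] orbit_mem_closed[OF G] by blast
  then show False using agree[of k c] orbit_self[OF G] by (metis less_irrefl)
qed

text \<open>Since the group acts by isometries, moving the base point to first order by 0 keeps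
  the maximum over its orbit unchanged to first order.\<close>
lemma inner_derivative_orbit_max:
  fixes x p :: "real \<Rightarrow> 'a::euclidean_space"
  assumes G: "orth_group G"
    and x: "(x has_vector_derivative 0) (at 0)" and p: "(p has_vector_derivative p') (at 0)"
    and mem: "eventually (\<lambda>t. p t \<in> orbit G (x t)) (nhds 0)"
    and max: "\<And>q. q \<in> orbit G (x 0) \<Longrightarrow> z \<bullet> q \<le> z \<bullet> p 0"
  shows "z \<bullet> p' = 0"
proof -
  \<comment> \<open>The subtracted term bounds the gain from moving the base point, so 0 is a local
    maximum of \<open>\<psi>\<close>; its own derivative at 0 is 0.\<close>
  define \<psi> where "\<psi> t = z \<bullet> p t - norm z * norm (x t - x 0)" for t
  have "((\<lambda>t. norm (x t - x 0)) has_derivative (\<lambda>t. 0)) (at 0)"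
    using x unfolding has_vector_derivative_def has_derivative_at_alt by simp
  then have "((\<lambda>t. norm (x t - x 0)) has_real_derivative 0) (at 0)"
    by (simp add: has_field_derivative_def lambda_zero)
  moreover have "((\<lambda>t. z \<bullet> p t) has_real_derivative z \<bullet> p') (at 0)"
    using bounded_linear.has_vector_derivative[OF bounded_linear_inner_right p]
    by (simp add: has_real_derivative_iff_has_vector_derivative)
  ultimately have \<psi>': "(\<psi> has_real_derivative (z \<bullet> p')) (at 0)"
    unfolding \<psi>_def by (auto intro!: derivative_eq_intros)
  have le: "\<psi> t \<le> \<psi> 0" if t: "p t \<in> orbit G (x t)" for t
  proof -
    obtain g where g: "g \<in> G" "p t = g (x t)" using t by (auto simp: orbit_def)
    have "z \<bullet> p t = z \<bullet> g (x 0) + z \<bullet> g (x t - x 0)"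
      using orth_group_linear[OF G g(1)] by (simp add: g(2) linear_diff inner_diff_right)
    moreover have "z \<bullet> g (x 0) \<le> z \<bullet> p 0" using g(1) by (intro max) (simp add: orbit_def)
    moreover have "z \<bullet> g (x t - x 0) \<le> norm z * norm (x t - x 0)"
      using norm_cauchy_schwarz[of z "g (x t - x 0)"] orth_group_norm[OF G g(1)] by simp
    ultimately show ?thesis by (simp add: \<psi>_def)
  qed
  obtain d where "d > 0" "\<And>t. dist t 0 < d \<Longrightarrow> p t \<in> orbit G (x t)"
    using mem unfolding eventually_nhds_metric by blast
  then have "\<forall>t. \<bar>0 - t\<bar> < d \<longrightarrow> \<psi> t \<le> \<psi> 0" using le by (auto simp: dist_real_def)
  then show ?thesis using DERIV_local_max[OF \<psi>' \<open>d > 0\<close>] by simp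
qed

text \<open>\<open>T\<close> factors through \<open>S\<close>, by a linear right inverse of
  \<open>S\<close> on its range.\<close>

lemma dim_range_le_if_kernel_subset:
  fixes S :: "'a::euclidean_space \<Rightarrow> 'b::euclidean_space" and T :: "'a \<Rightarrow> 'c::euclidean_space"
  assumes S: "linear S" and T: "linear T" and ker: "\<And>x. S x = 0 \<Longrightarrow> T x = 0"
  shows "dim (range T) \<le> dim (range S)"
proof -
  obtain g where g: "linear g" "\<And>v. v \<in> range S \<Longrightarrow> S (g v) = v"
    using linear_exists_right_inverse_on[OF S subspace_UNIV] by blast
  have "T x = T (g (S x))" for x
    using ker[of "x - g (S x)"] g S T by (simp add: linear_diff)
  then have "range T \<subseteq> (T \<circ> g) ` range S" by auto
  then have "dim (range T) \<le> dim ((T \<circ> g) ` range S)" by (rule dim_subset)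
  also have "\<dots> \<le> dim (range S)" using g T by (intro dim_image_le linear_compose)
  finally show ?thesis .
qed

section \<open>Colliding orbits\<close>

lemma vector_derivative_eq_0_if_eventually_const:
  assumes f: "(f has_vector_derivative f') (at a)" and c: "eventually (\<lambda>t. f t = c) (nhds a)"
  shows "f' = 0"
proof -
  have "((\<lambda>t. c) has_derivative (\<lambda>t. 0)) (at a)" by simp
  then have "(f has_derivative (\<lambda>t. 0)) (at a)"
  proof (rule has_derivative_transform_eventually)
    show "eventually (\<lambda>t. c = f t) (at a)"
      using c by (auto simp: eventually_nhds_conv_at elim: eventually_mono)
    show "c = f a" using eventually_nhds_x_imp_x[OF c] by simp
  qed simp
  then have "(f has_vector_derivative 0) (at a)" by (simp add: has_vector_derivative_def)
  with f show ?thesis by (rule vector_derivative_unique_at)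
qed

lemma pol_inner:
  assumes "\<And>j. (\<lambda>e. f e $ j) \<in> pol V" "\<And>j. (\<lambda>e. g e $ j) \<in> pol V"
  shows "(\<lambda>e. f e \<bullet> (g e :: real^'d)) \<in> pol V"
  unfolding inner_vec_def by (auto intro!: pol_sum pol_mult assms)

lemma pol_tform_homog:
  assumes "\<And>j. (\<lambda>e. f e $ j) \<in> pol V"
  shows "(\<lambda>e. tform k c (homog (f e :: real^'d))) \<in> pol V"
proof (induction k arbitrary: c)
  case (Suc k)
  have "(\<lambda>e. homog (f e) a) \<in> pol V" for a
    using assms by (cases a) (simp_all add: homog_def pol_const)
  then show ?case by (auto intro!: pol_sum pol_mult Suc.IH)
qed (simp add: pol_const)

text \<open>A point of \<open>real ^ ('n, 'd) var\<close> encodes a tuple \<open>(z, x, y, p, q)\<close>.\<close>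
type_synonym ('n, 'd) var = "('n \<times> 'd) + ('d + 'd) + (('n \<times> 'd) + ('n \<times> 'd))"

definition tuple :: "real^'d^'n \<Rightarrow> real^'d \<Rightarrow> real^'d \<Rightarrow> real^'d^'n \<Rightarrow> real^'d^'n \<Rightarrow> real^('n::finite, 'd::finite) var" where
  "tuple z x y p q = (\<chi> v. case v of
      Inl (i, j) \<Rightarrow> z $ i $ j
    | Inr (Inl (Inl j)) \<Rightarrow> x $ j
    | Inr (Inl (Inr j)) \<Rightarrow> y $ j
    | Inr (Inr (Inl (i, j))) \<Rightarrow> p $ i $ j
    | Inr (Inr (Inr (i, j))) \<Rightarrow> q $ i $ j)"

definition zpart :: "real^('n::finite, 'd::finite) var \<Rightarrow> real^'d^'n" where
  "zpart e = (\<chi> i j. e $ Inl (i, j))"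
definition xpart :: "real^('n::finite, 'd::finite) var \<Rightarrow> real^'d" where
  "xpart e = (\<chi> j. e $ Inr (Inl (Inl j)))"
definition ypart :: "real^('n::finite, 'd::finite) var \<Rightarrow> real^'d" where
  "ypart e = (\<chi> j. e $ Inr (Inl (Inr j)))"
definition ppart :: "real^('n::finite, 'd::finite) var \<Rightarrow> real^'d^'n" where
  "ppart e = (\<chi> i j. e $ Inr (Inr (Inl (i, j))))"
definition qpart :: "real^('n::finite, 'd::finite) var \<Rightarrow> real^'d^'n" where
  "qpart e = (\<chi> i j. e $ Inr (Inr (Inr (i, j))))"

lemmas part_defs = zpart_def xpart_def ypart_def ppart_def qpart_def

lemma parts_tuple [simp]:
  "zpart (tuple z x y p q) = z" "xpart (tuple z x y p q) = x" "ypart (tuple z x y p q) = y"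
  "ppart (tuple z x y p q) = p" "qpart (tuple z x y p q) = q"
  by (simp_all add: part_defs tuple_def vec_eq_iff)

lemma linear_parts: "linear zpart" "linear xpart" "linear ypart" "linear ppart" "linear qpart"
  by (auto intro!: linearI simp: part_defs vec_eq_iff)

lemma linear_tuple_z: "linear (\<lambda>z. tuple z 0 0 0 0)"
  by (rule linearI) (auto simp: tuple_def vec_eq_iff split: sum.split)

lemma pol_parts:
  "(\<lambda>e. zpart e $ i $ j) \<in> pol UNIV" "(\<lambda>e. xpart e $ j) \<in> pol UNIV" "(\<lambda>e. ypart e $ j) \<in> pol UNIV"
  "(\<lambda>e. ppart e $ i $ j) \<in> pol UNIV" "(\<lambda>e. qpart e $ i $ j) \<in> pol UNIV"
  by (simp_all add: part_defs pol_var)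

text \<open>The \<open>Inl\<close> variables are the coordinates of \<open>z\<close>; this passes to
  the polynomials used by \<open>generic\<close>.\<close>

lemma pol_z_polyfun:
  fixes P :: "real^('n::finite, 'd::finite) var \<Rightarrow> real"
  assumes "P \<in> pol (range Inl)"
  shows "(\<lambda>z. P (tuple z 0 0 0 0)) \<in> polyfun"
  using assms
proof induction
  case (pol_var v)
  then obtain i j where v: "v = Inl (i, j)" by auto
  have "z $ i $ j = z \<bullet> axis i (axis j 1)" for z :: "real^'d^'n" by (simp add: inner_axis)
  moreover have "axis i (axis j 1) \<in> (Basis :: (real^'d^'n) set)" by (simp add: axis_in_Basis_iff)
  ultimately show ?case using pcoord[of "axis i (axis j 1)"] by (simp add: v tuple_def del: axis_in_Basis_iff)
qed (auto intro: polyfun.intros)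

text \<open>Normalising \<open>(x, y)\<close> removes the freedom of joint scaling, which lowers the
  count of stationarity conditions from \<open>2d\<close> to \<open>2d - 1\<close>.\<close>

definition collisions :: "(real^'d \<Rightarrow> real^'d) set \<Rightarrow> (real^('n::finite, 'd::finite) var) set" where
  "collisions G = {e. orbit G (xpart e) \<noteq> orbit G (ypart e) \<and> xpart e \<bullet> xpart e + ypart e \<bullet> ypart e = 1 \<and>
    (\<forall>i. ppart e $ i \<in> orbit G (xpart e) \<and> qpart e $ i \<in> orbit G (ypart e) \<and>
      zpart e $ i \<bullet> ppart e $ i = zpart e $ i \<bullet> qpart e $ i \<and>
      (\<forall>p'\<in>orbit G (xpart e). zpart e $ i \<bullet> p' \<le> zpart e $ i \<bullet> ppart e $ i) \<and>
      (\<forall>q'\<in>orbit G (ypart e). zpart e $ i \<bullet> q' \<le> zpart e $ i \<bullet> qpart e $ i))}"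

text \<open>Two distinct orbits with equal max filters are not both zero, and orbits and maximisers
  scale together by positive factors.\<close>

lemma collision_if_not_injective:
  fixes z :: "real^'d^'n::finite"
  assumes G: "orth_group G" and cl: "\<And>x. closed (orbit G x)"
    and ninj: "\<not> inj_on (\<lambda>Ob. (\<chi> i. maxfilt (orbit G (z $ i)) Ob) :: real^'n) (orbit_space G)"
  shows "\<exists>e\<in>collisions G. zpart e = z"
proof -
  obtain x y where ne: "orbit G x \<noteq> orbit G y"
    and eq: "\<And>i. maxfilt (orbit G (z $ i)) (orbit G x) = maxfilt (orbit G (z $ i)) (orbit G y)"
    using ninj unfolding inj_on_def orbit_space_def by (auto simp: vec_eq_iff)
  have attained: "\<exists>p\<in>orbit G v. maxfilt (orbit G (z $ i)) (orbit G v) = z $ i \<bullet> p \<and>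
      (\<forall>p'\<in>orbit G v. z $ i \<bullet> p' \<le> z $ i \<bullet> p)" for v i
    by (rule maxfilt_orbit_attained[OF G cl[of v], of "z $ i"]) (rule bexI, auto)
  obtain p where p: "\<And>i. p i \<in> orbit G x" "\<And>i. maxfilt (orbit G (z $ i)) (orbit G x) = z $ i \<bullet> p i"
    "\<And>i p'. p' \<in> orbit G x \<Longrightarrow> z $ i \<bullet> p' \<le> z $ i \<bullet> p i"
    using attained[of x] by metis
  obtain q where q: "\<And>i. q i \<in> orbit G y" "\<And>i. maxfilt (orbit G (z $ i)) (orbit G y) = z $ i \<bullet> q i"
    "\<And>i q'. q' \<in> orbit G y \<Longrightarrow> z $ i \<bullet> q' \<le> z $ i \<bullet> q i"
    using attained[of y] by metis
  define s where "s = inverse (sqrt (x \<bullet> x + y \<bullet> y))"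
  have "x \<bullet> x + y \<bullet> y > 0"
  proof -
    have "x \<noteq> 0 \<or> y \<noteq> 0" using ne by auto
    then show ?thesis by (auto intro: add_pos_nonneg add_nonneg_pos)
  qed
  then have s: "s > 0" "s\<^sup>2 * (x \<bullet> x + y \<bullet> y) = 1"
    by (simp_all add: s_def power_inverse)
  have unscale: "inverse s *\<^sub>R u \<in> orbit G v" if "u \<in> orbit G (s *\<^sub>R v)" for u v
    using orbit_scaleR_mem[OF G that, of "inverse s"] s(1) by simp
  have max: "w \<bullet> u \<le> w \<bullet> (s *\<^sub>R b)" if "u \<in> orbit G (s *\<^sub>R v)" "\<And>a. a \<in> orbit G v \<Longrightarrow> w \<bullet> a \<le> w \<bullet> b" for u v b w
  proof -
    have "w \<bullet> (inverse s *\<^sub>R u) \<le> w \<bullet> b" using that unscale by blast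
    then show ?thesis using s(1) by (simp add: field_simps)
  qed
  let ?e = "tuple z (s *\<^sub>R x) (s *\<^sub>R y) (\<chi> i. s *\<^sub>R p i) (\<chi> i. s *\<^sub>R q i)"
  have "orbit G (s *\<^sub>R x) \<noteq> orbit G (s *\<^sub>R y)"
  proof
    assume "orbit G (s *\<^sub>R x) = orbit G (s *\<^sub>R y)"
    then have "s *\<^sub>R x \<in> orbit G (s *\<^sub>R y)" using orbit_self[OF G] by metis
    from unscale[OF this] show False using s(1) ne by (simp add: orbit_eq_iff[OF G])
  qed
  moreover have "s *\<^sub>R x \<bullet> s *\<^sub>R x + s *\<^sub>R y \<bullet> s *\<^sub>R y = 1"
    using s(2) by (simp add: algebra_simps power2_eq_square)
  moreover have "z $ i \<bullet> (s *\<^sub>R p i) = z $ i \<bullet> (s *\<^sub>R q i)" for i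
    using eq[of i] by (simp add: p(2) q(2))
  ultimately have "?e \<in> collisions G"
    unfolding collisions_def using orbit_scaleR_mem[OF G] p(1) q(1) max[OF _ p(3)] max[OF _ q(3)]
    by simp
  then show ?thesis by force
qed

text \<open>Maximality and distinctness of the orbits are not polynomial equations and are used at
  \<open>e0\<close> only; along the section only the equations and orbit memberships
  persist.\<close>

lemma collisions_not_dense:
  fixes G :: "(real^'d \<Rightarrow> real^'d) set"
  assumes G: "orth_group G" and cl: "\<And>x. closed (orbit G x)" and n: "CARD('n::finite) \<ge> 2 * CARD('d)"
  shows "\<exists>P::real^('n, 'd) var \<Rightarrow> real. P \<in> pol (range Inl) \<and> P \<noteq> (\<lambda>e. 0) \<and> (\<forall>e\<in>collisions G. P e = 0)"
proof (rule ccontr)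
  assume "\<not> ?thesis"
  then have dense: "P = (\<lambda>e. 0)" if "P \<in> pol (range Inl)" "\<And>e. e \<in> collisions G \<Longrightarrow> P e = 0"
    for P :: "real^('n, 'd) var \<Rightarrow> real" using that by blast
  obtain e0 :: "real^('n, 'd) var" and w where e0: "e0 \<in> collisions G" "w e0 = e0" "w differentiable (at e0)"
    and wz: "\<And>e v. v \<in> range Inl \<Longrightarrow> w e $ v = e $ v"
    and van: "eventually (\<lambda>e. \<forall>f\<in>pol UNIV. (\<forall>e\<in>collisions G. f e = 0) \<longrightarrow> f (w e) = 0) (nhds e0)"
    using local_section_if_dense[of "range Inl" "collisions G", OF dense] by blast
  have zw: "zpart (w e) = zpart e" for e using wz by (simp add: zpart_def)
  have near: "eventually (\<lambda>e. xpart (w e) \<bullet> xpart (w e) + ypart (w e) \<bullet> ypart (w e) = 1 \<and>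
      (\<forall>i. zpart e $ i \<bullet> ppart (w e) $ i = zpart e $ i \<bullet> qpart (w e) $ i \<and>
        ppart (w e) $ i \<in> orbit G (xpart (w e)) \<and> qpart (w e) $ i \<in> orbit G (ypart (w e)))) (nhds e0)"
    using van
  proof eventually_elim
    case (elim e)
    then have el: "f (w e) = 0" if "f \<in> pol UNIV" "\<And>e. e \<in> collisions G \<Longrightarrow> f e = 0" for f
      using that by blast
    \<comment> \<open>Each invariant form gives an equation valid on all collisions, hence also at
      \<open>w e\<close>.\<close>
    have mem: "f (w e) \<in> orbit G (g (w e))"
      if fg: "\<And>j. (\<lambda>e. f e $ j) \<in> pol UNIV" "\<And>j. (\<lambda>e. g e $ j) \<in> pol UNIV"
        and col: "\<And>e. e \<in> collisions G \<Longrightarrow> f e \<in> orbit G (g e)" for f g :: "real^('n, 'd) var \<Rightarrow> real^'d"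
    proof (rule mem_orbit_if_invariants_agree[OF G cl])
      fix k c assume inv: "\<And>h u. h \<in> G \<Longrightarrow> tform k c (homog (h u)) = tform k c (homog u)"
      have "tform k c (homog (f (w e))) - tform k c (homog (g (w e))) = 0"
      proof (rule el)
        show "(\<lambda>e. tform k c (homog (f e)) - tform k c (homog (g e))) \<in> pol UNIV"
          by (intro pol_diff pol_tform_homog fg)
        show "tform k c (homog (f e)) - tform k c (homog (g e)) = 0" if "e \<in> collisions G" for e
          using col[OF that] inv by (auto simp: orbit_def)
      qed
      then show "tform k c (homog (f (w e))) = tform k c (homog (g (w e)))" by simp
    qed
    have "xpart (w e) \<bullet> xpart (w e) + ypart (w e) \<bullet> ypart (w e) - 1 = 0"
      by (rule el) (auto intro!: pol_diff pol_add pol_inner pol_parts pol_const simp: collisions_def)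
    moreover have "zpart (w e) $ i \<bullet> ppart (w e) $ i - zpart (w e) $ i \<bullet> qpart (w e) $ i = 0" for i
      by (rule el) (auto intro!: pol_diff pol_inner pol_parts simp: collisions_def)
    moreover have "ppart (w e) $ i \<in> orbit G (xpart (w e))" for i
      by (rule mem[of "\<lambda>e. ppart e $ i"]) (auto intro: pol_parts simp: collisions_def)
    moreover have "qpart (w e) $ i \<in> orbit G (ypart (w e))" for i
      by (rule mem[of "\<lambda>e. qpart e $ i"]) (auto intro: pol_parts simp: collisions_def)
    ultimately show ?case by (simp add: zw)
  qed
  let ?z = "zpart e0" and ?x = "xpart e0" and ?y = "ypart e0" and ?p = "ppart e0" and ?q = "qpart e0"
  note col = e0(1)[unfolded collisions_def mem_Collect_eq]
  have maxpq: "p' \<in> orbit G ?x \<Longrightarrow> ?z $ i \<bullet> p' \<le> ?z $ i \<bullet> ?p $ i"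
    "q' \<in> orbit G ?y \<Longrightarrow> ?z $ i \<bullet> q' \<le> ?z $ i \<bullet> ?q $ i" for i p' q'
    using col by blast+
  have pq: "?p $ i \<noteq> ?q $ i" for i
    using col orbit_eq_if_mem[OF G] by metis
  obtain w' where w': "(w has_derivative w') (at e0)" using e0(3) unfolding differentiable_def by blast
  have linw: "linear w'" using w' by (rule has_derivative_linear)
  define emb :: "real^'d^'n \<Rightarrow> real^('n, 'd) var" where "emb \<zeta> = tuple \<zeta> 0 0 0 0" for \<zeta>
  have lemb: "linear emb" unfolding emb_def by (rule linear_tuple_z)
  have curve: "((\<lambda>t. f (w (e0 + t *\<^sub>R emb \<zeta>))) has_vector_derivative f (w' (emb \<zeta>))) (at 0)"
    if "linear f" for \<zeta> and f :: "_ \<Rightarrow> 'z::euclidean_space"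
  proof -
    have "((\<lambda>t. w (e0 + t *\<^sub>R emb \<zeta>)) has_derivative (\<lambda>t. w' (t *\<^sub>R emb \<zeta>))) (at 0)"
      by (rule has_derivative_compose[where f = "\<lambda>t. e0 + t *\<^sub>R emb \<zeta>" and g = w])
        (auto intro!: derivative_eq_intros simp: w')
    then have "((\<lambda>t. w (e0 + t *\<^sub>R emb \<zeta>)) has_vector_derivative w' (emb \<zeta>)) (at 0)"
      by (simp add: has_vector_derivative_def linear_scale[OF linw])
    moreover have "bounded_linear f" using that by (simp add: linear_conv_bounded_linear)
    ultimately show ?thesis using bounded_linear.has_vector_derivative by blast
  qed
  have nearc: "eventually (\<lambda>t. Q (e0 + t *\<^sub>R emb \<zeta>)) (nhds 0)" if "eventually Q (nhds e0)" for Q \<zeta>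
  proof -
    have "((\<lambda>t. e0 + t *\<^sub>R emb \<zeta>) \<longlongrightarrow> e0 + 0 *\<^sub>R emb \<zeta>) (nhds 0)"
      by (intro tendsto_intros tendsto_ident_at) (simp add: filterlim_ident)
    then show ?thesis using that by (simp add: filterlim_iff)
  qed
  \<comment> \<open>\<open>S\<close> records the first-order motion of \<open>(x, y)\<close> when
    \<open>z\<close> moves along \<open>\<zeta>\<close>; \<open>T\<close> collects the
    \<open>n\<close> conditions on \<open>\<zeta>\<close>.\<close>
  define S where "S \<zeta> = (xpart (w' (emb \<zeta>)), ypart (w' (emb \<zeta>)))" for \<zeta>
  define T where "T \<zeta> = (\<chi> i. \<zeta> $ i \<bullet> (?p $ i - ?q $ i))" for \<zeta> :: "real^'d^'n"
  have linS: "linear S"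
    by (rule linearI)
      (simp_all add: S_def linear_add[OF lemb] linear_add[OF linw] linear_add[OF linear_parts(2)]
        linear_add[OF linear_parts(3)] linear_scale[OF lemb] linear_scale[OF linw]
        linear_scale[OF linear_parts(2)] linear_scale[OF linear_parts(3)])
  have linT: "linear T"
    by (rule linearI) (auto simp: T_def vec_eq_iff inner_add_left)
  have ker: "T \<zeta> = 0" if S0: "S \<zeta> = 0" for \<zeta>
  proof -
    let ?e = "\<lambda>t. e0 + t *\<^sub>R emb \<zeta>"
    have x0: "((\<lambda>t. xpart (w (?e t))) has_vector_derivative 0) (at 0)"
      and y0: "((\<lambda>t. ypart (w (?e t))) has_vector_derivative 0) (at 0)"
      using curve[OF linear_parts(2), of \<zeta>] curve[OF linear_parts(3), of \<zeta>] S0 by (simp_all add: S_def zero_prod_def)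
    have "\<zeta> $ i \<bullet> (?p $ i - ?q $ i) = 0" for i
    proof -
      have lin: "linear (\<lambda>e. ppart e $ i)" "linear (\<lambda>e. qpart e $ i)"
        by (auto intro!: linearI simp: part_defs vec_eq_iff)
      let ?p' = "ppart (w' (emb \<zeta>)) $ i" and ?q' = "qpart (w' (emb \<zeta>)) $ i"
      note p' = curve[OF lin(1), of \<zeta>] and q' = curve[OF lin(2), of \<zeta>]
      have memp: "eventually (\<lambda>t. ppart (w (?e t)) $ i \<in> orbit G (xpart (w (?e t)))) (nhds 0)"
        and memq: "eventually (\<lambda>t. qpart (w (?e t)) $ i \<in> orbit G (ypart (w (?e t)))) (nhds 0)"
        by (use nearc[OF near, of \<zeta>] in eventually_elim, blast)+
      have "?z $ i \<bullet> ?p' = 0"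
        by (rule inner_derivative_orbit_max[OF G x0 p' memp]) (simp add: e0(2) maxpq)
      moreover have "?z $ i \<bullet> ?q' = 0"
        by (rule inner_derivative_orbit_max[OF G y0 q' memq]) (simp add: e0(2) maxpq)
      moreover have "?z $ i \<bullet> ?p' + \<zeta> $ i \<bullet> ?p $ i - (?z $ i \<bullet> ?q' + \<zeta> $ i \<bullet> ?q $ i) = 0"
      proof -
        let ?f = "\<lambda>t. zpart (?e t) $ i \<bullet> ppart (w (?e t)) $ i - zpart (?e t) $ i \<bullet> qpart (w (?e t)) $ i"
        have "zpart (?e t) $ i = ?z $ i + t *\<^sub>R \<zeta> $ i" for t
          by (simp add: linear_add[OF linear_parts(1)] linear_scale[OF linear_parts(1)] emb_def)
        then have "((\<lambda>t. zpart (?e t) $ i) has_vector_derivative \<zeta> $ i) (at 0)"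
          by (auto intro!: derivative_eq_intros)
        note z' = this
        have "(?f has_vector_derivative (?z $ i \<bullet> ?p' + \<zeta> $ i \<bullet> ?p $ i - (?z $ i \<bullet> ?q' + \<zeta> $ i \<bullet> ?q $ i))) (at 0)"
          using has_vector_derivative_diff[OF
              bounded_bilinear.has_vector_derivative[OF bounded_bilinear_inner z' p']
              bounded_bilinear.has_vector_derivative[OF bounded_bilinear_inner z' q']]
          by (simp add: e0(2))
        moreover have "eventually (\<lambda>t. ?f t = 0) (nhds 0)"
          using nearc[OF near, of \<zeta>] by eventually_elim simp
        ultimately show ?thesis by (rule vector_derivative_eq_0_if_eventually_const)
      qed
      ultimately show ?thesis by (simp add: inner_diff_right)
    qed
    then show ?thesis by (simp add: T_def vec_eq_iff)
  qed
  \<comment> \<open>Each \<open>p\<^sub>i - q\<^sub>i\<close> is nonzero, so the components can be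
    prescribed independently.\<close>
  have "surj T"
  proof (rule surjI)
    fix v :: "real^'n"
    show "T (\<chi> i. (v $ i / ((?p $ i - ?q $ i) \<bullet> (?p $ i - ?q $ i))) *\<^sub>R (?p $ i - ?q $ i)) = v"
      using pq by (simp add: T_def vec_eq_iff)
  qed
  then have "CARD('n) = dim (range T)" by simp
  also have "\<dots> \<le> dim (range S)" by (rule dim_range_le_if_kernel_subset[OF linS linT ker])
  \<comment> \<open>Differentiating the normalisation confines the motion of \<open>(x, y)\<close>
    to a hyperplane.\<close>
  also have "\<dots> \<le> dim {v. (?x, ?y) \<bullet> v = 0}"
  proof (rule dim_subset, clarsimp)
    fix \<zeta>
    let ?e = "\<lambda>t. e0 + t *\<^sub>R emb \<zeta>"
    let ?f = "\<lambda>t. xpart (w (?e t)) \<bullet> xpart (w (?e t)) + ypart (w (?e t)) \<bullet> ypart (w (?e t))"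
    note x' = curve[OF linear_parts(2), of \<zeta>] and y' = curve[OF linear_parts(3), of \<zeta>]
    have "(?f has_vector_derivative 2 * ((?x, ?y) \<bullet> S \<zeta>)) (at 0)"
      using has_vector_derivative_add[OF
              bounded_bilinear.has_vector_derivative[OF bounded_bilinear_inner x' x']
              bounded_bilinear.has_vector_derivative[OF bounded_bilinear_inner y' y']]
      by (simp add: e0(2) S_def inner_commute)
    moreover have "eventually (\<lambda>t. ?f t = 1) (nhds 0)"
      using nearc[OF near, of \<zeta>] by eventually_elim simp
    ultimately have "2 * ((?x, ?y) \<bullet> S \<zeta>) = 0" by (rule vector_derivative_eq_0_if_eventually_const)
    then show "(?x, ?y) \<bullet> S \<zeta> = 0" by simp
  qed
  also have "\<dots> = 2 * CARD('d) - 1"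
  proof -
    have "(?x, ?y) \<noteq> 0" using col by (auto simp: zero_prod_def)
    then show ?thesis by (simp add: dim_hyperplane)
  qed
  finally show False using n by (simp add: le_diff_conv2) 
qed

section \<open>Assembly of the three claims\<close>

theorem theorem5:
  fixes G :: "(real^'d \<Rightarrow> real^'d) set"
  assumes "orth_group G"
  shows "((\<exists>x. \<not> closed (orbit G x)) \<longrightarrow>
            (\<forall>(X::'b topology) h. t1_space X \<and> continuous_map (quotient_top G) X h
                \<longrightarrow> \<not> inj_on h (orbit_space G)))
       \<and> ((\<forall>x. orbit G x = sphere 0 (norm x)) \<longrightarrow>
            (\<forall>z. z \<noteq> 0 \<longrightarrow> inj_on (\<lambda>Ob. maxfilt (orbit G z) Ob) (orbit_space G)))
       \<and> ((\<forall>x. closed (orbit G x)) \<and> CARD('n::finite) \<ge> 2 * CARD('d) \<longrightarrow>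
            generic (\<lambda>z::real^'d^'n.
               inj_on (\<lambda>Ob. (\<chi> i. maxfilt (orbit G (z $ i)) Ob) :: real^'n) (orbit_space G)))"
proof (intro conjI impI)
  assume "\<exists>x. \<not> closed (orbit G x)"
  then show "\<forall>(X::'b topology) h. t1_space X \<and> continuous_map (quotient_top G) X h
                \<longrightarrow> \<not> inj_on h (orbit_space G)"
    using closed_orbit_if_injective[OF assms] by blast
next
  assume sph: "\<forall>x. orbit G x = sphere 0 (norm x)"
  show "\<forall>z. z \<noteq> 0 \<longrightarrow> inj_on (\<lambda>Ob. maxfilt (orbit G z) Ob) (orbit_space G)"
  proof (intro allI impI inj_onI)
    fix z :: "real^'d" and A B
    assume z: "z \<noteq> 0" and AB: "A \<in> orbit_space G" "B \<in> orbit_space G"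
      and eq: "maxfilt (orbit G z) A = maxfilt (orbit G z) B"
    obtain x y :: "real^'d" where xy: "A = sphere 0 (norm x)" "B = sphere 0 (norm y)"
      using AB sph unfolding orbit_space_def by auto
    then show "A = B" using eq sph maxfilt_spheres[OF z, of x] maxfilt_spheres[OF z, of y] z by simp
  qed
next
  assume "(\<forall>x. closed (orbit G x)) \<and> CARD('n::finite) \<ge> 2 * CARD('d)"
  then have cl: "\<And>x. closed (orbit G x)" and n: "CARD('n) \<ge> 2 * CARD('d)" by auto
  obtain P :: "real^('n, 'd) var \<Rightarrow> real" where P: "P \<in> pol (range Inl)" "P \<noteq> (\<lambda>e. 0)"
    "\<And>e. e \<in> collisions G \<Longrightarrow> P e = 0"
    using collisions_not_dense[OF assms cl n] by blast
  \<comment> \<open>\<open>P\<close> involves the coordinates of \<open>z\<close> only, so the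
    others may be set to 0.\<close>
  have P0: "P (tuple (zpart e) 0 0 0 0) = P e" for e
    by (rule pol_cong[OF P(1)]) (auto simp: tuple_def zpart_def)
  obtain a where "P a \<noteq> 0" using P(2) by blast
  show "generic (\<lambda>z::real^'d^'n.
          inj_on (\<lambda>Ob. (\<chi> i. maxfilt (orbit G (z $ i)) Ob) :: real^'n) (orbit_space G))"
  proof (rule generic_if_polyfun[OF pol_z_polyfun[OF P(1)]])
    show "P (tuple (zpart a) 0 0 0 0) \<noteq> 0" using \<open>P a \<noteq> 0\<close> by (simp add: P0)
  next
    fix z :: "real^'d^'n"
    assume "P (tuple z 0 0 0 0) \<noteq> 0"
    then show "inj_on (\<lambda>Ob. (\<chi> i. maxfilt (orbit G (z $ i)) Ob) :: real^'n) (orbit_space G)"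
      using collision_if_not_injective[OF assms cl] P(3) P0 by metis
  qed
qed

end
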